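(* The Fricke involution $W_5:\tau\mapsto-1/(5\tau)$ maps $A(q)$ to $\gamma_1\sqrt[5]{\tau}\,C(q)$ and $B(q)$ to $\gamma_2\sqrt[5]{\tau}\,D(q)$ for some constants $\gamma_1,\gamma_2\in\mathbb C$; that is, there exist $\gamma_1,\gamma_2\in\mathbb C$ such that, writing $A(\tau),B(\tau),C(\tau),D(\tau)$ for the quintic theta functions as functions of $\tau$ with $q=e^{2\pi i\tau}$, for all $\tau$ with $\operatorname{Im}\tau>0$, $$A\Bigl(-\frac1{5\tau}\Bigr)=\gamma_1\,\tau^{1/5}\,C(\tau),\qquad B\Bigl(-\frac1{5\tau}\Bigr)=\gamma_2\,\tau^{1/5}\,D(\tau).$$
   Context: $q=e^{2\pi i\tau}$ with $\operatorname{Im}\tau>0$, $q^{1/5}=e^{2\pi i\tau/5}$; $\tau^{1/5}$ is the branch of the fifth root with argument in $[0,2\pi/5)$. $(a;q)_\infty=\prod_{k\ge0}(1-aq^k)$, and fractional powers of $(q;q)_\infty$, $(q^5;q^5)_\infty$ are the branches whose power series have constant term $1$. The quintic theta functions are $$A(q)=q^{1/5}(q;q)_\infty^{-3/5}\sum_{n=-\infty}^{\infty}(-1)^nq^{(5n^2-3n)/2},\qquad B(q)=(q;q)_\infty^{-3/5}\sum_{n=-\infty}^{\infty}(-1)^nq^{(5n^2-n)/2},$$ $$C(q)=\frac{(q^5;q^5)_\infty^{-3/5}}{1+e^{3\pi i/5}}\sum_{n=-\infty}^{\infty}e^{3\pi in/5}q^{(n^2-n)/2},\qquad D(q)=\frac{(q^5;q^5)_\infty^{-3/5}}{1+e^{\pi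 i/5}}\sum_{n=-\infty}^{\infty}e^{\pi in/5}q^{(n^2-n)/2}.$$ *)

theory Defs
  imports "HOL-Complex_Analysis.Complex_Analysis"
begin

definition qpoch_inf :: "complex \<Rightarrow> complex \<Rightarrow> complex" where
  "qpoch_inf a q = (\<Prod>k. 1 - a * q ^ k)"

definition is_euler_branch :: "(complex \<Rightarrow> complex) \<Rightarrow> bool" where
  "is_euler_branch f \<longleftrightarrow>
     f holomorphic_on ball 0 1 \<and> f 0 = 1 \<and>
     (\<forall>z\<in>ball 0 1. f z ^ 5 = inverse (qpoch_inf z z ^ 3))"

text \<open>
  The power $(q;q)_\infty^{-3/5}$ for $|q| < 1$, in the branch whose power series in $q$ has
  constant term $1$. This branch exists and is unique on the unit disc, see
  \<open>is_euler_branch_euler_pow\<close> and \<open>is_euler_branch_unique\<close> below.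
\<close>
definition euler_pow :: "complex \<Rightarrow> complex" where
  "euler_pow q = (THE w. \<exists>f. is_euler_branch f \<and> f q = w)"

text \<open>The branch of the fifth root with argument in $[0, 2\pi/5)$.\<close>
definition fifth_root :: "complex \<Rightarrow> complex" where
  "fifth_root z = (THE w. w ^ 5 = z \<and> Arg2pi w < 2 * pi / 5)"

definition nome :: "complex \<Rightarrow> complex" where
  "nome \<tau> = exp (2 * of_real pi * \<i> * \<tau>)"

text \<open>
  The quintic theta functions as functions of $\tau$. The integer divisions by $2$ are exact.
  In \<open>qtheta_A\<close>, the first factor is $q^{1/5} = e^{2\pi i\tau/5}$.
\<close>
definition qtheta_A :: "complex \<Rightarrow> complex" where
  "qtheta_A \<tau> = (let q = nome \<tau> in
     exp (2 * of_real pi * \<i> * \<tau> / 5) * euler_pow q *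
     (\<Sum>\<^sub>\<infinity>n::int. (-1) powi n * q powi ((5 * n^2 - 3 * n) div 2)))"

definition qtheta_B :: "complex \<Rightarrow> complex" where
  "qtheta_B \<tau> = (let q = nome \<tau> in
     euler_pow q *
     (\<Sum>\<^sub>\<infinity>n::int. (-1) powi n * q powi ((5 * n^2 - n) div 2)))"

definition qtheta_C :: "complex \<Rightarrow> complex" where
  "qtheta_C \<tau> = (let q = nome \<tau> in
     euler_pow (q ^ 5) / (1 + exp (3 * of_real pi * \<i> / 5)) *
     (\<Sum>\<^sub>\<infinity>n::int. exp (3 * of_real pi * \<i> * of_int n / 5) * q powi ((n^2 - n) div 2)))"

definition qtheta_D :: "complex \<Rightarrow> complex" where
  "qtheta_D \<tau> = (let q = nome \<tau> in
     euler_pow (q ^ 5) / (1 + exp (of_real pi * \<i> / 5)) *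
     (\<Sum>\<^sub>\<infinity>n::int. exp (of_real pi * \<i> * of_int n / 5) * q powi ((n^2 - n) div 2)))"

definition fricke5 :: "complex \<Rightarrow> complex" where
  "fricke5 \<tau> = - 1 / (5 * \<tau>)"


subsection \<open>Well-definedness of the branches\<close>

lemma uniformly_convergent_euler_prod:
  assumes "0 < r" "r < 1"
  shows "uniformly_convergent_on (cball 0 r) (\<lambda>N z::complex. \<Prod>k<N. 1 - z * z ^ k)"
proof -
  have "uniformly_convergent_on (cball 0 r) (\<lambda>N x::complex. \<Sum>n<N. norm (- (x * x ^ n)))"
  proof (rule Weierstrass_m_test'_ev)
    show "\<forall>\<^sub>F n in sequentially. \<forall>x\<in>cball 0 r. norm (norm (- (x * x ^ n) :: complex)) \<le> r ^ n"
    proof (intro always_eventually allI ballI)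
      fix n and x :: complex assume "x \<in> cball 0 r"
      hence x: "norm x \<le> r" by simp
      have "norm x * norm x ^ n \<le> 1 * r ^ n"
        by (intro mult_mono power_mono) (use x assms in auto)
      thus "norm (norm (- (x * x ^ n))) \<le> r ^ n" by (simp add: norm_mult norm_power)
    qed
    show "summable (\<lambda>n. r ^ n)" using assms by (simp add: summable_geometric)
  qed
  hence "uniformly_convergent_on (cball 0 r) (\<lambda>N x::complex. \<Prod>n<N. 1 + - (x * x ^ n))"
    by (intro uniformly_convergent_on_prod) (auto intro!: continuous_intros)
  thus ?thesis by simp
qed

lemma convergent_prod_euler:
  assumes "norm (z::complex) < 1"
  shows "convergent_prod (\<lambda>k. 1 - z * z ^ k)"
proof -
  have "summable (\<lambda>k. norm (- (z * z ^ k)))"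
    using assms by (auto simp: norm_mult norm_power intro!: summable_mult summable_geometric)
  hence "abs_convergent_prod (\<lambda>k. 1 + - (z * z ^ k))"
    using summable_imp_abs_convergent_prod[of "\<lambda>k. 1 + - (z * z ^ k)"] by simp
  thus ?thesis using abs_convergent_prod_imp_convergent_prod by simp
qed

lemma euler_factor_nonzero: "norm (z::complex) < 1 \<Longrightarrow> 1 - z * z ^ k \<noteq> 0"
  using power_less_one_iff[of "norm z" "Suc k"]
  by (metis eq_iff_diff_eq_0 less_irrefl norm_ge_zero norm_one norm_power power_Suc zero_less_Suc)

lemma qpoch_inf_euler_nonzero: "norm z < 1 \<Longrightarrow> qpoch_inf z z \<noteq> 0"
  unfolding qpoch_inf_def
  by (rule prodinf_nonzero[OF convergent_prod_euler euler_factor_nonzero])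

lemma holomorphic_qpoch_inf_euler: "(\<lambda>z. qpoch_inf z z) holomorphic_on ball 0 1"
proof (rule holomorphic_uniform_sequence[where f = "\<lambda>N z. \<Prod>k<N. 1 - z * z ^ k"])
  fix x :: complex assume "x \<in> ball 0 1"
  hence x: "norm x < 1" by simp
  define d where "d = (1 - norm x) / 2"
  have d: "d > 0" using x by (simp add: d_def)
  have r: "norm x + d < 1" "0 < norm x + d"
    using x d norm_ge_zero[of x] by (auto simp: d_def field_simps add_pos_nonneg simp del: norm_ge_zero)
  have sub: "cball x d \<subseteq> cball 0 (norm x + d)"
    by (simp add: cball_subset_cball_iff add.commute)
  have sub1: "cball x d \<subseteq> ball 0 1" using sub r by force
  have "uniformly_convergent_on (cball 0 (norm x + d)) (\<lambda>N z::complex. \<Prod>k<N. 1 - z * z ^ k)"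
    using r by (intro uniformly_convergent_euler_prod) auto
  then obtain l where l: "uniform_limit (cball 0 (norm x + d)) (\<lambda>N z::complex. \<Prod>k<N. 1 - z * z ^ k) l sequentially"
    by (auto simp: uniformly_convergent_on_def)
  have "l z = qpoch_inf z z" if "z \<in> cball x d" for z
  proof -
    have "norm z < 1" using sub1 that by auto
    from convergent_prod_has_prod[OF convergent_prod_euler[OF this]]
    have "(\<lambda>N. \<Prod>k<N. 1 - z * z ^ k) \<longlonglongrightarrow> qpoch_inf z z"
      unfolding qpoch_inf_def by (rule has_prod_imp_tendsto')
    moreover have "(\<lambda>N. \<Prod>k<N. 1 - z * z ^ k) \<longlonglongrightarrow> l z"
      using tendsto_uniform_limitI[OF l] that sub by blast
    ultimately show ?thesis using LIMSEQ_unique by blast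
  qed
  moreover have "uniform_limit (cball x d) (\<lambda>N z. \<Prod>k<N. 1 - z * z ^ k) l sequentially"
    using l sub by (rule uniform_limit_on_subset)
  ultimately have "uniform_limit (cball x d) (\<lambda>N z. \<Prod>k<N. 1 - z * z ^ k) (\<lambda>z. qpoch_inf z z) sequentially"
    by (subst uniform_limit_cong') auto
  thus "\<exists>d>0. cball x d \<subseteq> ball 0 1 \<and>
          uniform_limit (cball x d) (\<lambda>N z. \<Prod>k<N. 1 - z * z ^ k) (\<lambda>z. qpoch_inf z z) sequentially"
    using d sub1 by blast
qed (auto intro!: holomorphic_intros)

lemma is_euler_branch_exists: "\<exists>f. is_euler_branch f"
proof -
  have "simply_connected (ball 0 1 :: complex set)"
    by (simp add: convex_imp_simply_connected)
  hence log: "\<forall>f. f holomorphic_on ball 0 1 \<and> (\<forall>z\<in>ball 0 1. f z \<noteq> 0) \<longrightarrow>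
               (\<exists>g. g holomorphic_on ball 0 1 \<and> (\<forall>z\<in>ball (0::complex) 1. f z = exp (g z)))"
    by (subst (asm) simply_connected_eq_holomorphic_log[OF open_ball]) (rule conjunct2)
  have "\<forall>z\<in>ball 0 1. qpoch_inf z z \<noteq> 0"
    using qpoch_inf_euler_nonzero by simp
  with log[rule_format, of "\<lambda>z. qpoch_inf z z"] holomorphic_qpoch_inf_euler
  obtain g where g: "g holomorphic_on ball 0 1" "\<And>z. z \<in> ball 0 1 \<Longrightarrow> qpoch_inf z z = exp (g z)"
    by blast
  have g0: "exp (g 0) = 1"
    using g(2)[of 0] by (simp add: qpoch_inf_def)
  define f where "f = (\<lambda>z. exp (- 3 / 5 * (g z - g 0)))"
  have "f holomorphic_on ball 0 1" unfolding f_def by (intro holomorphic_intros g)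
  moreover have "f z ^ 5 = inverse (qpoch_inf z z ^ 3)" if "z \<in> ball 0 1" for z
  proof -
    have "f z ^ 5 = exp (of_nat 5 * (- 3 / 5 * (g z - g 0)))"
      by (simp only: f_def exp_of_nat_mult)
    also have "of_nat 5 * (- 3 / 5 * (g z - g 0)) = - (3 * g z) + 3 * g 0"
      by (simp add: divide_simps)
    also have "exp (- (3 * g z) + 3 * g 0) = exp (- (3 * g z)) * exp (g 0) ^ 3"
      using exp_of_nat_mult[of 3 "g 0"] by (simp only: exp_add of_nat_numeral)
    also have "\<dots> = inverse (qpoch_inf z z ^ 3)"
      unfolding g(2)[OF that] g0
      using exp_of_nat_mult[of 3 "g z"] by (simp add: exp_minus)
    finally show ?thesis .
  qed
  ultimately have "is_euler_branch f" by (simp add: is_euler_branch_def f_def)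
  thus ?thesis by blast
qed

lemma is_euler_branch_unique:
  assumes f: "is_euler_branch f" and g: "is_euler_branch g" and q: "norm q < 1"
  shows "f q = g q"
proof -
  have nz: "f z \<noteq> 0" "g z \<noteq> 0" and eq: "(f z / g z) ^ 5 = 1" if "z \<in> ball 0 1" for z
  proof -
    have "f z ^ 5 = inverse (qpoch_inf z z ^ 3)" "g z ^ 5 = inverse (qpoch_inf z z ^ 3)"
      using f g that by (auto simp: is_euler_branch_def)
    moreover have "inverse (qpoch_inf z z ^ 3) \<noteq> 0" using qpoch_inf_euler_nonzero that by simp
    ultimately show "f z \<noteq> 0" "g z \<noteq> 0" "(f z / g z) ^ 5 = 1"
      by (auto simp: power_divide)
  qed
  have "(\<lambda>z. f z / g z) constant_on ball 0 1"
  proof (rule continuous_finite_range_constant)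
    show "continuous_on (ball 0 1) (\<lambda>z. f z / g z)"
      using f g nz unfolding is_euler_branch_def
      by (intro continuous_intros holomorphic_on_imp_continuous_on) auto
    have "finite {w::complex. w ^ 5 = 1}" by (rule finite_roots_unity) simp
    thus "finite ((\<lambda>z. f z / g z) ` ball 0 1)"
      by (rule rev_finite_subset) (use eq in auto)
  qed auto
  then obtain c where c: "\<And>z. z \<in> ball 0 1 \<Longrightarrow> f z / g z = c" by (auto simp: constant_on_def)
  have "c = 1" using c[of 0] f g by (simp add: is_euler_branch_def)
  thus ?thesis using c[of q] nz[of q] q by (simp add: field_simps)
qed

lemma euler_pow_eq: "is_euler_branch f \<Longrightarrow> norm q < 1 \<Longrightarrow> euler_pow q = f q"
  unfolding euler_pow_def by (rule the_equality) (blast intro: is_euler_branch_unique)+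

lemma is_euler_branch_euler_pow: "is_euler_branch euler_pow"
proof -
  obtain f where f: "is_euler_branch f" using is_euler_branch_exists by blast
  have eq: "euler_pow z = f z" if "z \<in> ball 0 1" for z
    using euler_pow_eq[OF f] that by simp
  have "euler_pow holomorphic_on ball 0 1 \<longleftrightarrow> f holomorphic_on ball 0 1"
    by (rule holomorphic_cong) (use eq in auto)
  with f show ?thesis unfolding is_euler_branch_def by (simp add: eq)
qed

lemma fifth_root_eq:
  assumes "z \<noteq> 0"
  shows "fifth_root z = of_real (root 5 (norm z)) * exp (\<i> * of_real (Arg2pi z / 5))"
  unfolding fifth_root_def
proof (rule the_equality)
  let ?w = "of_real (root 5 (norm z)) * exp (\<i> * of_real (Arg2pi z / 5))"
  have root: "root 5 (norm z) ^ 5 = norm z" by (simp add: real_root_pow_pos2)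
  have "?w ^ 5 = of_real (root 5 (norm z) ^ 5) * exp (of_nat 5 * (\<i> * of_real (Arg2pi z / 5)))"
    by (simp only: power_mult_distrib exp_of_nat_mult of_real_power)
  also have "\<dots> = z" unfolding root using Arg2pi_eq[of z] by simp
  finally have 1: "?w ^ 5 = z" .
  have "Arg2pi ?w = Arg2pi z / 5"
    by (rule Arg2pi_unique[OF refl]) (use assms Arg2pi_ge_0[of z] Arg2pi_lt_2pi[of z] in auto)
  with 1 show "?w ^ 5 = z \<and> Arg2pi ?w < 2 * pi / 5"
    using Arg2pi_lt_2pi[of z] by simp
next
  fix w assume w: "w ^ 5 = z \<and> Arg2pi w < 2 * pi / 5"
  hence "w \<noteq> 0" using assms by auto
  have norm: "norm w ^ 5 = norm z" using w by (simp flip: norm_power)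
  have "of_real (norm z) * exp (\<i> * of_real (5 * Arg2pi w)) =
        of_real (norm w ^ 5) * exp (of_nat 5 * (\<i> * of_real (Arg2pi w)))"
    by (simp add: norm mult_ac)
  also have "\<dots> = (of_real (norm w) * exp (\<i> * of_real (Arg2pi w))) ^ 5"
    by (simp only: power_mult_distrib exp_of_nat_mult of_real_power)
  also have "\<dots> = z" using w Arg2pi_eq[of w] by simp
  finally have "Arg2pi z = 5 * Arg2pi w"
    using assms w Arg2pi_ge_0[of w] by (intro Arg2pi_unique) auto
  moreover have "root 5 (norm z) = norm w"
    by (simp add: real_root_power_cancel flip: norm)
  ultimately show "w = of_real (root 5 (norm z)) * exp (\<i> * of_real (Arg2pi z / 5))"
    using Arg2pi_eq[of w] by simp
qed

end

theory Submission
  imports Defs "HOL-Probability.Probability"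
begin

text \<open>
  Up to powers of \<open>q\<close>, each quintic theta function is the product of \<open>\<eta>(\<tau>)\<^sup>-\<^sup>3\<^sup>/\<^sup>5\<close> or
  \<open>\<eta>(5\<tau>)\<^sup>-\<^sup>3\<^sup>/\<^sup>5\<close> and a Jacobi theta series. Poisson summation transforms the theta series with a
  factor \<open>\<tau>\<^sup>1\<^sup>/\<^sup>2\<close>. The pentagonal number theorem makes \<open>\<eta>\<close> a theta series as well, so its transformation law
  follows up to a constant; since all constants are free, the branch of the fifth root only has to be
  controlled by continuity on the upper half-plane. The weights add up to \<open>1/2 - 3/10 = 1/5\<close>.
\<close>

subsection \<open>Jacobi theta series\<close>

text \<open>Completing the square shows where the shapes of the four functions come from. With the
  prefactor q^(1/5) included, A and B are eta^(-3/5) times the sum of (-1)^n q^((5/2)(n - r/10)^2),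
  for r = 3 and r = 1. C and D are constants times eta(5\<tau>)^(-3/5) times the sum of e^(pi i r
  n/5) q^((n - 1/2)^2/2). Poisson summation exchanges shifts and characters: the shift r/10 becomes
  the character e^(pi i r n/5), and the sign (-1)^n becomes the shift 1/2. Hence one argument with a
  parameter r covers both identities. The obstacle lies in eta: Poisson summation does not return
  its series directly but one whose residue classes modulo 3 have to be separated, two of them being
  multiples of the wanted series and the third being zero. The square root of i/\<tau> from the
  theta series and the one from the power of eta are the same function, so it disappears and only
  the fifth root of \<tau> stays.\<close>

lemma summable_on_intI:
  fixes f :: "int \<Rightarrow> real"
  assumes "(\<lambda>n::nat. f (int n)) summable_on UNIV" "(\<lambda>n::nat. f (- int n)) summable_on UNIV"
  shows "f summable_on UNIV"
proof -
  have inj: "inj (\<lambda>n. - int n)" by (auto simp: inj_def)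
  have "f summable_on (range int \<union> range (\<lambda>n. - int n))"
  proof (rule summable_on_union)
    show "f summable_on range int"
      using assms(1) by (simp add: summable_on_reindex o_def)
    show "f summable_on range (\<lambda>n. - int n)"
      using assms(2) by (simp add: summable_on_reindex[OF inj] o_def)
  qed
  also have "range int \<union> range (\<lambda>n. - int n) = UNIV"
  proof -
    have "x \<in> range int \<union> range (\<lambda>n. - int n)" for x
      by (cases x rule: int_cases2) auto
    thus ?thesis by blast
  qed
  finally show ?thesis .
qed

lemma filterlim_symmetric_int_interval:
  "filterlim (\<lambda>n::nat. {- int n..int n}) (finite_subsets_at_top UNIV) sequentially"
  unfolding filterlim_finite_subsets_at_top
proof (intro allI impI)
  fix X :: "int set" assume X: "finite X \<and> X \<subseteq> UNIV"
  define N where "N = nat (Max (insert 0 (abs ` X)))"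
  have N: "\<bar>x\<bar> \<le> int N" if "x \<in> X" for x
  proof -
    have "\<bar>x\<bar> \<le> Max (insert 0 (abs ` X))" using X that by (intro Max_ge) auto
    thus ?thesis unfolding N_def by linarith
  qed
  show "\<forall>\<^sub>F n in sequentially. finite {- int n..int n} \<and> X \<subseteq> {- int n..int n} \<and> {- int n..int n} \<subseteq> UNIV"
    using eventually_ge_at_top[of N]
  proof eventually_elim
    case (elim n)
    have "x \<in> {-int n..int n}" if "x \<in> X" for x using N[OF that] elim by auto
    thus ?case by auto
  qed
qed

lemma has_sum_int_imp_LIMSEQ:
  "(f has_sum S) (UNIV :: int set) \<Longrightarrow> (\<lambda>N. \<Sum>n\<in>{-int N..int N}. f n) \<longlonglongrightarrow> S"
  unfolding has_sum_def by (rule filterlim_compose[OF _ filterlim_symmetric_int_interval])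

text \<open>The common majorant of the theta series: \<open>B * \<bar>n\<bar>\<close> absorbs a
  linear term of either sign.\<close>

lemma summable_gaussian_int:
  fixes \<epsilon> B :: real
  assumes "\<epsilon> > 0"
  shows "(\<lambda>n::int. exp (- \<epsilon> * of_int n ^ 2 + B * \<bar>of_int n\<bar>)) summable_on UNIV"
proof -
  have *: "(\<lambda>n::nat. exp (- \<epsilon> * real n ^ 2 + B * real n)) summable_on UNIV"
  proof (rule summable_nonneg_imp_summable_on)
    show "summable (\<lambda>n::nat. exp (- \<epsilon> * real n ^ 2 + B * real n))"
    proof (rule summable_comparison_test_ev)
      show "\<forall>\<^sub>F n in sequentially. norm (exp (- \<epsilon> * real n ^ 2 + B * real n)) \<le> exp (- 1) ^ n"
        \<comment> \<open>From this index on the quadratic term outweighs (B + 1) n, so the exponent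
          is at most -n.\<close>
        using eventually_ge_at_top[of "nat \<lceil>(B + 1) / \<epsilon>\<rceil>"]
      proof eventually_elim
        case (elim n)
        hence "(B + 1) / \<epsilon> \<le> real n" by linarith
        hence "B + 1 \<le> \<epsilon> * real n" using assms by (simp add: field_simps)
        hence "(B + 1) * real n \<le> \<epsilon> * real n * real n" by (intro mult_right_mono) auto
        thus ?case by (simp add: power2_eq_square algebra_simps flip: exp_of_nat_mult)
      qed
    qed (auto intro!: summable_geometric)
  qed auto
  show ?thesis by (rule summable_on_intI) (use * in simp_all)
qed

text \<open>With \<alpha> = pi i \<sigma> and \<beta> = 2 pi i z this is Jacobi's theta_3(z |
  \<sigma>). Taking the exponents themselves as parameters puts signs, characters and shifts of the
  summation index all into \<beta>.\<close>

definition jtheta :: "complex \<Rightarrow> complex \<Rightarrow> complex" where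
  "jtheta \<alpha> \<beta> = (\<Sum>\<^sub>\<infinity>n::int. exp (\<alpha> * of_int n ^ 2 + \<beta> * of_int n))"

text \<open>By compactness Re \<alpha> has a negative maximum and the norm of \<beta> a finite one,
  so a single Gaussian majorant serves the whole of K in the M-test. Convergence, holomorphy and
  termwise integration all rest on this.\<close>

lemma jtheta_uniform_limit:
  assumes "compact K" "continuous_on K \<alpha>" "continuous_on K \<beta>" "\<And>s. s \<in> K \<Longrightarrow> Re (\<alpha> s) < 0"
  shows "uniform_limit K (\<lambda>X s. \<Sum>n\<in>X. exp (\<alpha> s * of_int n ^ 2 + \<beta> s * of_int n))
           (\<lambda>s. jtheta (\<alpha> s) (\<beta> s)) (finite_subsets_at_top UNIV)"
proof (cases "K = {}")
  case False
  obtain s0 where s0: "s0 \<in> K" "\<And>s. s \<in> K \<Longrightarrow> Re (\<alpha> s) \<le> Re (\<alpha> s0)"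
    using continuous_attains_sup[OF assms(1) False, of "\<lambda>s. Re (\<alpha> s)"] assms(2)
    by (auto intro: continuous_intros)
  obtain s1 where s1: "s1 \<in> K" "\<And>s. s \<in> K \<Longrightarrow> norm (\<beta> s) \<le> norm (\<beta> s1)"
    using continuous_attains_sup[OF assms(1) False, of "\<lambda>s. norm (\<beta> s)"] assms(3)
    by (auto intro: continuous_intros)
  show ?thesis unfolding jtheta_def
  proof (rule Weierstrass_m_test_general)
    show "(\<lambda>n::int. exp (- (- Re (\<alpha> s0)) * of_int n ^ 2 + norm (\<beta> s1) * \<bar>of_int n\<bar>)) summable_on UNIV"
      using assms(4)[OF s0(1)] by (intro summable_gaussian_int) auto
    fix n :: int and s assume s: "s \<in> K"
    have 1: "Re (\<alpha> s) * of_int n ^ 2 \<le> Re (\<alpha> s0) * of_int n ^ 2"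
      using s0(2)[OF s] by (intro mult_right_mono) auto
    have "Re (\<beta> s) * of_int n \<le> \<bar>Re (\<beta> s)\<bar> * \<bar>of_int n\<bar>"
      by (metis abs_ge_self abs_mult)
    also have "\<dots> \<le> norm (\<beta> s1) * \<bar>of_int n\<bar>"
      using s1(2)[OF s] abs_Re_le_cmod[of "\<beta> s"] by (intro mult_right_mono) auto
    finally have 2: "Re (\<beta> s) * of_int n \<le> norm (\<beta> s1) * \<bar>of_int n\<bar>" .
    have "of_int n ^ 2 = complex_of_real (of_int n ^ 2)" by simp
    hence "Re (\<alpha> s * of_int n ^ 2) = Re (\<alpha> s) * of_int n ^ 2"
      by (simp only: Re_complex_of_real Im_complex_of_real times_complex.sel)
    moreover have "Re (\<beta> s * of_int n) = Re (\<beta> s) * of_int n" by simp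
    ultimately show "norm (exp (\<alpha> s * of_int n ^ 2 + \<beta> s * of_int n))
       \<le> exp (- (- Re (\<alpha> s0)) * of_int n ^ 2 + norm (\<beta> s1) * \<bar>of_int n\<bar>)"
      using 1 2 by (simp del: Re_power2)
  qed
qed (auto simp: uniform_limit_iff)

lemma jtheta_has_sum:
  assumes "Re \<alpha> < 0"
  shows "((\<lambda>n::int. exp (\<alpha> * of_int n ^ 2 + \<beta> * of_int n)) has_sum jtheta \<alpha> \<beta>) UNIV"
  unfolding has_sum_def
  using tendsto_uniform_limitI[OF jtheta_uniform_limit[of "{0::complex}" "\<lambda>_. \<alpha>" "\<lambda>_. \<beta>"]] assms
  by auto

lemma jtheta_holomorphic:
  assumes "open S" "\<alpha> holomorphic_on S" "\<beta> holomorphic_on S" "\<And>s. s \<in> S \<Longrightarrow> Re (\<alpha> s) < 0"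
  shows "(\<lambda>s. jtheta (\<alpha> s) (\<beta> s)) holomorphic_on S"
proof (rule holomorphic_uniform_sequence[OF assms(1),
    where f = "\<lambda>N s. \<Sum>n\<in>{-int N..int N}. exp (\<alpha> s * of_int n ^ 2 + \<beta> s * of_int n)"])
  fix x assume "x \<in> S"
  then obtain d where d: "d > 0" "cball x d \<subseteq> S" using assms(1) open_contains_cball by blast
  have "uniform_limit (cball x d) (\<lambda>N s. \<Sum>n\<in>{-int N..int N}. exp (\<alpha> s * of_int n ^ 2 + \<beta> s * of_int n))
           (\<lambda>s. jtheta (\<alpha> s) (\<beta> s)) sequentially"
    by (rule filterlim_compose[OF jtheta_uniform_limit filterlim_symmetric_int_interval])
       (use assms d in \<open>auto intro: continuous_on_subset holomorphic_on_imp_continuous_on\<close>)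
  with d show "\<exists>d>0. cball x d \<subseteq> S \<and> uniform_limit (cball x d)
     (\<lambda>N s. \<Sum>n\<in>{-int N..int N}. exp (\<alpha> s * of_int n ^ 2 + \<beta> s * of_int n))
           (\<lambda>s. jtheta (\<alpha> s) (\<beta> s)) sequentially" by blast
qed (intro holomorphic_intros assms)

text \<open>Shift of the summation index by 1: quasi-periodicity of theta under z to z +
  \<sigma>.\<close>

lemma jtheta_period:
  assumes "Re \<alpha> < 0"
  shows "jtheta \<alpha> \<beta> = exp (\<alpha> + \<beta>) * jtheta \<alpha> (\<beta> + 2 * \<alpha>)"
proof -
  have "jtheta \<alpha> \<beta> = (\<Sum>\<^sub>\<infinity>n::int. exp (\<alpha> * of_int (n + 1) ^ 2 + \<beta> * of_int (n + 1)))"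
    unfolding jtheta_def
    by (rule infsum_reindex_bij_witness[of _ "\<lambda>n. n + 1" "\<lambda>n. n - 1"]) auto
  also have "\<dots> = (\<Sum>\<^sub>\<infinity>n::int. exp (\<alpha> + \<beta>) * exp (\<alpha> * of_int n ^ 2 + (\<beta> + 2 * \<alpha>) * of_int n))"
    by (intro infsum_cong) (simp add: power2_eq_square algebra_simps flip: exp_add)
  finally show ?thesis unfolding jtheta_def by (simp add: infsum_cmult_right')
qed

lemma jtheta_minus: "jtheta \<alpha> (- \<beta>) = jtheta \<alpha> \<beta>"
  unfolding jtheta_def
  by (rule infsum_reindex_bij_witness[of _ "\<lambda>n. - n" "\<lambda>n. - n"]) auto

subsection \<open>Poisson summation\<close>

text \<open>One integration by parts: the boundary terms and the integral of p' times the
  oscillation stay bounded, while differentiating the oscillation produces the factor r N. So the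
  integral is O(1/N). The sign of r is left open because both ends of the Dirichlet kernel occur
  later.\<close>

lemma riemann_lebesgue_holomorphic:
  fixes p :: "complex \<Rightarrow> complex" and r a b :: real
  assumes hol: "p holomorphic_on S" and S: "open S" "\<And>x. x \<in> {a..b} \<Longrightarrow> of_real x \<in> S"
    and ab: "a \<le> b" and r: "r \<noteq> 0"
  shows "(\<lambda>N::nat. integral {a..b} (\<lambda>x. p (of_real x) * exp (\<i> * of_real (r * real N * x)))) \<longlonglongrightarrow> 0"
proof -
  define E where "E = (\<lambda>(N::nat) x. exp (\<i> * of_real (r * real N * x)))"
  define q where "q = deriv p"
  have cont: "continuous_on {a..b} (\<lambda>x. g (of_real x))" if "g holomorphic_on S" for g :: "complex \<Rightarrow> complex"
    by (rule continuous_on_compose2[OF holomorphic_on_imp_continuous_on[OF that]])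
       (use S in \<open>auto intro: continuous_intros\<close>)
  note cont_p = cont[OF hol]
  have cont_q: "continuous_on {a..b} (\<lambda>x. q (of_real x))"
    unfolding q_def by (rule cont[OF holomorphic_deriv[OF hol S(1)]])
  have "bounded ((\<lambda>x. q (of_real x)) ` {a..b})"
    using cont_q by (intro compact_imp_bounded compact_continuous_image) auto
  then obtain B where B: "\<And>x. x \<in> {a..b} \<Longrightarrow> norm (q (of_real x)) \<le> B"
    unfolding bounded_iff by blast
  define C where "C = (norm (p b) + norm (p a) + B * (b - a)) / \<bar>r\<bar>"
  have normE: "norm (E N x) = 1" for N x unfolding E_def by (rule norm_exp_i_times)
  have cont_E: "continuous_on {a..b} (E N)" for N unfolding E_def by (intro continuous_intros)
  have bound: "norm (integral {a..b} (\<lambda>x. p (of_real x) * E N x)) \<le> C / real N" if N: "N > 0" for N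
  proof -
    define I where "I = integral {a..b} (\<lambda>x. p (of_real x) * E N x)"
    define J where "J = integral {a..b} (\<lambda>x. q (of_real x) * E N x)"
    have "((\<lambda>x. p (of_real x) * E N x) has_vector_derivative
            (q (of_real x) * E N x + (\<i> * of_real (r * real N)) * (p (of_real x)
                * E N x))) (at x within {a..b})"
      if "x \<in> {a..b}" for x
    proof -
      have "(p has_field_derivative q (of_real x)) (at (of_real x))"
        unfolding q_def using hol S that by (intro holomorphic_derivI) auto
      hence 1: "((\<lambda>x. p (of_real x)) has_vector_derivative q (of_real x)) (at x within {a..b})"
        by (rule has_vector_derivative_real_field)
      have "((\<lambda>x. exp (\<i> * of_real (r * real N) * x)) has_field_derivative
              \<i> * of_real (r * real N) * exp (\<i> * of_real (r * real N) * of_real x)) (at (of_real x))"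
        by (auto intro!: derivative_eq_intros)
      hence "((\<lambda>x. exp (\<i> * of_real (r * real N) * of_real x)) has_vector_derivative
              \<i> * of_real (r * real N) * exp (\<i> * of_real (r * real N)
                  * of_real x)) (at x within {a..b})"
        by (rule has_vector_derivative_real_field)
      hence 2: "(E N has_vector_derivative \<i> * of_real (r * real N) * E N x) (at x within {a..b})"
        unfolding E_def by (simp add: mult_ac)
      show ?thesis using has_vector_derivative_mult[OF 1 2] by (simp add: algebra_simps)
    qed
    hence "((\<lambda>x. q (of_real x) * E N x + (\<i> * of_real (r * real N)) * (p (of_real x) * E N x))
             has_integral (p b * E N b - p a * E N a)) {a..b}"
      by (intro fundamental_theorem_of_calculus ab) auto
    moreover have "((\<lambda>x. q (of_real x) * E N x + (\<i> * of_real (r * real N)) * (p (of_real x) * E N x))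
             has_integral (J + (\<i> * of_real (r * real N)) * I)) {a..b}"
      unfolding I_def J_def
      by (intro has_integral_add has_integral_mult_right integrable_integral
            integrable_continuous_real continuous_intros cont_p cont_q cont_E)
    ultimately have "J + (\<i> * of_real (r * real N)) * I = p b * E N b - p a * E N a"
      by (rule has_integral_unique[rotated])
    hence "(\<i> * of_real (r * real N)) * I = p b * E N b - p a * E N a - J" by (simp add: algebra_simps)
    hence "norm ((\<i> * of_real (r * real N)) * I) = norm (p b * E N b - p a * E N a - J)" by simp
    also have "\<dots> \<le> norm (p b * E N b) + norm (p a * E N a) + norm J"
      by (meson norm_triangle_ineq4 norm_triangle_le_diff order_trans add_right_mono)
    also have "\<dots> \<le> norm (p b) + norm (p a) + B * (b - a)"
    proof -
      have "norm J \<le> B * (b - a)" unfolding J_def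
        using B by (intro integral_bound ab continuous_intros cont_q cont_E) (auto simp: norm_mult normE)
      thus ?thesis by (simp add: norm_mult normE)
    qed
    also have "norm ((\<i> * of_real (r * real N)) * I) = \<bar>r\<bar> * real N
        * norm I" by (simp add: norm_mult abs_mult)
    finally show ?thesis unfolding I_def C_def using r N by (simp add: field_simps)
  qed
  show ?thesis
  proof (rule Lim_null_comparison)
    show "(\<lambda>N. C / real N) \<longlonglongrightarrow> 0" by (rule lim_const_over_n)
    show "\<forall>\<^sub>F N in sequentially. norm (integral {a..b}
        (\<lambda>x. p (of_real x) * exp (\<i> * of_real (r * real N * x)))) \<le> C / real N"
      using eventually_gt_at_top[of "0::nat"] by eventually_elim (use bound in \<open>simp add: E_def\<close>)
  qed
qed

section \<open>The Dirichlet kernel and Fourier series at the origin\<close>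

lemma dirichlet_kernel_telescope:
  fixes z :: complex
  assumes "z \<noteq> 0"
  shows "(\<Sum>k\<in>{-int N..int N}. z powi (- k)) * (z - 1) = z powi (int N + 1) - z powi (- int N)"
proof (induction N)
  case 0
  then show ?case by simp
next
  case (Suc N)
  have "{-int (Suc N)..int (Suc N)} = insert (- int N - 1) (insert (int N + 1) {-int N..int N})" by auto
  hence "(\<Sum>k\<in>{-int (Suc N)..int (Suc N)}. z powi (- k)) =
      z powi (1 + int N) + z powi (- 1 - int N) + (\<Sum>k\<in>{-int N..int N}. z powi (- k))"
    by (simp add: add.commute)
  hence "(\<Sum>k\<in>{-int (Suc N)..int (Suc N)}. z powi (- k)) * (z - 1) =
      z powi (1 + int N) * z - z powi (1 + int N) + z powi (- 1 - int N) * z - z powi (- 1 - int N)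
       + (z powi (1 + int N) - z powi (- int N))"
    using Suc by (simp add: algebra_simps)
  also have "z powi (1 + int N) * z = z powi (int (Suc N) + 1)"
    using assms power_int_add_1[of z "1 + int N"] by (simp add: algebra_simps)
  also have "z powi (- 1 - int N) * z = z powi (- int N)"
    using assms power_int_add_1[of z "- 1 - int N"] by simp
  also have "- 1 - int N = - int (Suc N)"
    by simp
  finally show ?case
    by simp
qed

lemma integral_exp_period:
  fixes k :: int
  shows "((\<lambda>x::real. exp (- (2 * of_real pi * \<i> * of_int k * of_real x)) :: complex)
      has_integral (if k = 0 then 1 else 0)) {-1/2..1/2}"
proof (cases "k = 0")
  case True
  thus ?thesis using has_integral_const_real[of "1::complex" "-1/2" "1/2"] by simp
next
  case False
  define c where "c = - (2 * of_real pi * \<i> * of_int k :: complex)"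
  have c: "c \<noteq> 0" using False by (simp add: c_def)
  have "((\<lambda>x::real. exp (c * of_real x)) has_integral (exp (c * of_real (1/2)) / c - exp (c
      * of_real (-1/2)) / c)) {-1/2..1/2}"
  proof (rule fundamental_theorem_of_calculus)
    fix x :: real
    have "((\<lambda>z. exp (c * z) / c) has_field_derivative exp (c * of_real x)) (at (of_real x))"
      using c by (auto intro!: derivative_eq_intros)
    thus "((\<lambda>x. exp (c * of_real x) / c) has_vector_derivative exp (c
        * of_real x)) (at x within {-1/2..1/2})"
      by (rule has_vector_derivative_real_field)
  qed auto
  moreover have "exp (c * of_real (1/2)) = exp (c * of_real (-1/2))"
  proof -
    have "c * of_real (1/2) = c * of_real (-1/2) + (of_int (2 * (- k)) * of_real pi) * \<i>"
      by (simp add: c_def)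
    thus ?thesis unfolding exp_eq by (intro exI[of _ "- k"]) simp
  qed
  ultimately show ?thesis using False by (simp add: c_def mult_ac)
qed

text \<open>Chernoff's argument: after division by \<open>exp (2 * pi * i * z) - 1\<close>, multiplying with the
  Dirichlet kernel leaves two pure oscillations.\<close>
lemma fourier_series_at_0:
  fixes f :: "complex \<Rightarrow> complex"
  assumes f: "f holomorphic_on UNIV"
  shows "(\<lambda>N::nat. \<Sum>k\<in>{-int N..int N}. integral {-1/2..1/2} (\<lambda>x. f (of_real x) * exp (- (2
      * of_real pi * \<i> * of_int k * of_real x))))
           \<longlonglongrightarrow> f 0"
proof -
  \<comment> \<open>The quotient of f - f(0) by e^(2 pi i z) - 1 has a removable singularity at 0.
    Numerator and denominator are each divided by z and completed at 0 by the derivative, so that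
    their quotient \<open>p\<close> is holomorphic wherever \<open>v\<close> has no zero.\<close>
  define u where "u = (\<lambda>z. if z = 0 then deriv f 0 else (f z - f 0) / (z - 0))"
  define w where "w = (\<lambda>z. exp (2 * of_real pi * \<i> * z) :: complex)"
  define v where "v = (\<lambda>z. if z = 0 then deriv w 0 else (w z - w 0) / (z - 0))"
  have u: "u holomorphic_on ball 0 1" unfolding u_def
    by (intro pole_lemma) (use f in \<open>auto intro: holomorphic_on_subset\<close>)
  have v: "v holomorphic_on ball 0 1" unfolding v_def
    by (intro pole_lemma) (auto simp: w_def intro!: holomorphic_intros)
  have "(w has_field_derivative 2 * of_real pi * \<i>) (at 0)"
    unfolding w_def by (auto intro!: derivative_eq_intros)
  hence dw: "deriv w 0 = 2 * of_real pi * \<i>" by (rule DERIV_imp_deriv)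
  \<comment> \<open>The equation w(z) = 1 holds only at integers, and 0 is the only integer in the
    unit ball, which contains the period interval [-1/2, 1/2].\<close>
  have v_nz: "v z \<noteq> 0" if "z \<in> ball 0 1" for z
  proof (cases "z = 0")
    case False
    have "w z \<noteq> 1"
    proof
      assume "w z = 1"
      then obtain n :: int where n: "Re (2 * of_real pi * \<i> * z) = 0" "Im (2 * of_real pi * \<i> * z)
          = of_int (2 * n) * pi"
        unfolding w_def exp_eq_1 by auto
      hence "z = of_int n" by (auto simp: complex_eq_iff)
      with that have "\<bar>n\<bar> < 1" by (simp add: norm_of_int flip: of_int_abs)
      with \<open>z = of_int n\<close> False show False by simp
    qed
    thus ?thesis using False by (simp add: v_def w_def)
  qed (simp add: v_def dw)
  define p where "p = (\<lambda>z. u z / v z)"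
  have p: "p holomorphic_on ball 0 1" unfolding p_def by (intro holomorphic_intros u v v_nz)
  have p_eq: "p z * (w z - 1) = f z - f 0" if "z \<in> ball 0 1" for z
    using v_nz[OF that] by (auto simp: p_def u_def v_def w_def)
  define e where "e = (\<lambda>(r::real) (N::nat) (x::real). exp (\<i> * of_real (r * real N * x)))"
  define I where "I = (\<lambda>r (N::nat). integral {-1/2..1/2} (\<lambda>x. p (of_real x) * e r N x))"
  have in_ball: "complex_of_real x \<in> ball 0 1" if "x \<in> {-1/2..1/2}" for x
    using that by auto
  have I_lim: "I r \<longlonglongrightarrow> 0" if "r \<noteq> 0" for r
    unfolding I_def e_def using p that in_ball by (intro riemann_lebesgue_holomorphic[of _ "ball 0 1"]) auto
  have cont_p: "continuous_on {-1/2..1/2} (\<lambda>x. p (of_real x))"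
    by (rule continuous_on_compose2[OF holomorphic_on_imp_continuous_on[OF p]])
      (use in_ball in \<open>auto intro: continuous_intros\<close>)
  have cont_f: "continuous_on {-1/2..1/2} (\<lambda>x. f (of_real x))"
    by (rule continuous_on_compose2[OF holomorphic_on_imp_continuous_on[OF f]])
      (auto intro: continuous_intros)
  have int_pe: "((\<lambda>x. p (of_real x) * e r N x) has_integral I r N) {-1/2..1/2}" for r N
    unfolding I_def e_def by (intro integrable_integral integrable_continuous_real continuous_intros cont_p)
  define D where "D = (\<lambda>(N::nat) (x::real). \<Sum>k\<in>{-int N..int N}. exp (- (2 * of_real pi * \<i>
      * of_int k * of_real x)) :: complex)"
  have D_w: "D N x * (w (of_real x) - 1) = e (2 * pi) (N + 1) x - e (- (2 * pi)) N x" for N x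
  proof -
    have wpow: "w (of_real x) powi k = exp (2 * of_real pi * \<i> * of_int k * of_real x)" for k
      unfolding w_def exp_power_int by (simp add: mult_ac)
    have "D N x = (\<Sum>k\<in>{-int N..int N}. w (of_real x) powi (- k))"
      unfolding D_def wpow by simp
    hence "D N x * (w (of_real x) - 1) = w (of_real x) powi (int N + 1) - w (of_real x) powi (- int N)"
      using dirichlet_kernel_telescope[of "w (of_real x)" N] by (simp add: w_def)
    thus ?thesis unfolding wpow e_def by (simp add: algebra_simps)
  qed
  have "(\<Sum>k\<in>{-int N..int N}. integral {-1/2..1/2} (\<lambda>x. f (of_real x) * exp (- (2 * of_real pi * \<i>
      * of_int k * of_real x))))
          = f 0 + I (2 * pi) (N + 1) - I (- (2 * pi)) N" (is "?L = _") for N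
  proof -
    have 1: "((\<lambda>x. \<Sum>k\<in>{-int N..int N}. f (of_real x) * exp (- (2 * of_real pi * \<i> * of_int k
        * of_real x))) has_integral ?L) {-1/2..1/2}"
      by (intro has_integral_sum integrable_integral integrable_continuous_real continuous_intros cont_f) auto
    \<comment> \<open>Only k = 0 contributes to the integral of the kernel, so the constant part
      f(0) is reproduced exactly for every N.\<close>
    have "((\<lambda>x. f 0 * (\<Sum>k\<in>{-int N..int N}. exp (- (2 * of_real pi * \<i> * of_int k * of_real x))))
            has_integral (f 0 * (\<Sum>k\<in>{-int N..int N}. if k = 0 then 1 else 0))) {-1/2..1/2}"
      by (intro has_integral_mult_right has_integral_sum integral_exp_period) auto
    hence "((\<lambda>x. f 0 * D N x + (p (of_real x) * e (2 * pi) (N + 1) x - p (of_real x) * e (- (2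
        * pi)) N x))
            has_integral (f 0 + (I (2 * pi) (N + 1) - I (- (2 * pi)) N))) {-1/2..1/2}"
      unfolding D_def by (intro has_integral_add has_integral_diff int_pe) simp
    moreover have "f 0 * D N x + (p (of_real x) * e (2 * pi) (N + 1) x - p (of_real x) * e (- (2
        * pi)) N x)
        = (\<Sum>k\<in>{-int N..int N}. f (of_real x) * exp (- (2 * of_real pi * \<i> * of_int k * of_real x)))"
      if x: "x \<in> {-1/2..1/2}" for x
    proof -
      have "f 0 * D N x + (p (of_real x) * e (2 * pi) (N + 1) x - p (of_real x) * e (- (2 * pi)) N x)
          = f 0 * D N x + p (of_real x) * (D N x * (w (of_real x) - 1))"
        unfolding D_w by (simp add: algebra_simps)
      also have "\<dots> = f 0 * D N x + (f (of_real x) - f 0) * D N x"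
        unfolding p_eq[OF in_ball[OF x], symmetric] by (simp add: algebra_simps)
      also have "\<dots> = f (of_real x) * D N x" by (simp add: algebra_simps)
      finally show ?thesis unfolding D_def by (simp add: sum_distrib_left)
    qed
    ultimately have "((\<lambda>x. \<Sum>k\<in>{-int N..int N}. f (of_real x) * exp (- (2 * of_real pi * \<i> * of_int k
        * of_real x)))
        has_integral (f 0 + (I (2 * pi) (N + 1) - I (- (2 * pi)) N))) {-1/2..1/2}"
      by (rule has_integral_eq[rotated])
    from has_integral_unique[OF 1 this] show ?thesis by (simp add: add_diff_eq)
  qed
  moreover have "(\<lambda>N. f 0 + I (2 * pi) (N + 1) - I (- (2 * pi)) N) \<longlonglongrightarrow> f 0 + 0 - 0"
  proof (intro tendsto_intros)
    show "(\<lambda>N. I (2 * pi) (N + 1)) \<longlonglongrightarrow> 0"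
      using I_lim[of "2 * pi"] LIMSEQ_ignore_initial_segment[of "I (2 * pi)" 0 1] by simp
    show "I (- (2 * pi)) \<longlonglongrightarrow> 0" by (rule I_lim) simp
  qed
  ultimately show ?thesis by simp
qed

text \<open>An affine substitution turns the integral into the characteristic function of the
  standard normal distribution, which is known.\<close>

lemma gaussian_fourier:
  fixes t a :: real and k :: int
  assumes t: "t > 0"
  defines "\<psi> \<equiv> \<lambda>x::real. exp (- of_real (pi * t * (x + a) ^ 2) - 2 * of_real pi * \<i> * of_int k
      * of_real x)"
  shows "integrable lborel \<psi>"
    and "(\<integral>x. \<psi> x \<partial>lborel) = of_real (1 / sqrt t) * exp (- of_real (pi * of_int k ^ 2 / t) + 2
        * of_real pi * \<i> * of_int k * of_real a)"
proof -
  \<comment> \<open>The scale for which pi t (c y)^2 = y^2/2; then \<open>s\<close> is the frequency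
    -2 pi k measured in the variable y.\<close>
  define c where "c = 1 / sqrt (2 * pi * t)"
  have c: "c > 0" "c ^ 2 = 1 / (2 * pi * t)" using t by (simp_all add: c_def power_divide)
  define s where "s = - (2 * pi * of_int k * c)"
  define K where "K = of_real (sqrt (2 * pi)) * exp (2 * of_real pi * \<i> * of_int k * of_real a)"
  have eq: "\<psi> (- a + c * y) = K * (std_normal_density y *\<^sub>R exp (\<i> * of_real (s * y)))" for y
  proof -
    have "pi * t * (- a + c * y + a) ^ 2 = y ^ 2 / 2"
      using c t by (simp add: power_mult_distrib)
    hence "\<psi> (- a + c * y) = exp (- of_real (y ^ 2 / 2) - 2 * of_real pi * \<i> * of_int k
        * of_real (- a + c * y))"
      unfolding \<psi>_def by (simp only:)
    also have "- of_real (y ^ 2 / 2) - 2 * of_real pi * \<i> * of_int k * of_real (- a + c * y) =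
        2 * of_real pi * \<i> * of_int k * of_real a + (of_real (- (y ^ 2) / 2) + \<i> * of_real (s * y))"
      unfolding s_def by (simp add: algebra_simps)
    also have "exp \<dots> = exp (2 * of_real pi * \<i> * of_int k * of_real a)
        * (of_real (exp (- (y ^ 2) / 2)) * exp (\<i> * of_real (s * y)))"
      unfolding exp_add exp_of_real ..
    also have "exp (- (y ^ 2) / 2) = sqrt (2 * pi) * std_normal_density y"
      unfolding std_normal_density_def by simp
    finally show ?thesis by (simp add: K_def scaleR_conv_of_real mult_ac)
  qed
  have dens: "integrable lborel (\<lambda>y. std_normal_density y *\<^sub>R exp (\<i> * of_real (s * y)) :: complex)"
  proof (rule Bochner_Integration.integrable_bound)
    show "integrable lborel std_normal_density" by simp
    show "AE x in lborel. norm (std_normal_density x *\<^sub>R exp (\<i> * of_real (s * x)) :: complex)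
        \<le> norm (std_normal_density x)"
      by simp
  qed measurable
  have "integrable lborel (\<lambda>y. \<psi> (- a + c * y))" unfolding eq by (intro integrable_mult_right dens)
  thus "integrable lborel \<psi>"
    using c(1) by (subst (asm) lborel_integrable_real_affine_iff) auto
  have "(\<integral>x. \<psi> x \<partial>lborel) = \<bar>c\<bar> *\<^sub>R (\<integral>y. \<psi> (- a + c * y) \<partial>lborel)"
    using c(1) by (intro lborel_integral_real_affine) simp
  also have "\<dots> = c *\<^sub>R (K * (\<integral>y. std_normal_density y *\<^sub>R exp (\<i> * of_real (s * y)) \<partial>lborel))"
    unfolding eq integral_mult_right_zero using c(1) by (simp only: abs_of_pos)
  also have "(\<integral>y. std_normal_density y *\<^sub>R exp (\<i> * of_real (s * y)) \<partial>lborel)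
      = char std_normal_distribution s"
    unfolding char_def by (subst integral_density) auto
  also have "\<dots> = of_real (exp (- (s ^ 2) / 2))" by (simp add: char_std_normal_distribution)
  also have "s ^ 2 = 4 * pi ^ 2 * of_int k ^ 2 * c ^ 2"
    by (simp add: s_def power_mult_distrib)
  also have "\<dots> = 2 * pi * of_int k ^ 2 / t"
    unfolding c(2) using t by (simp add: power2_eq_square)
  also have "c *\<^sub>R (K * of_real (exp (- (2 * pi * of_int k ^ 2 / t) / 2))) =
     of_real (c * sqrt (2 * pi)) * (exp (- of_real (pi * of_int k ^ 2 / t)) * exp (2 * of_real pi
         * \<i> * of_int k * of_real a))"
    unfolding K_def by (simp add: scaleR_conv_of_real mult_ac flip: exp_of_real)
  also have "c * sqrt (2 * pi) = 1 / sqrt t"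
    using t by (simp add: c_def real_sqrt_mult)
  finally show "(\<integral>x. \<psi> x \<partial>lborel) = of_real (1 / sqrt t) * exp (- of_real (pi * of_int k ^ 2 / t)
      + 2 * of_real pi * \<i> * of_int k * of_real a)"
    unfolding exp_add .
qed

text \<open>Unit intervals centred at -N, ..., N tile the interval from -N - 1/2 to N + 1/2. This is
  the unfolding step of Poisson summation in a finite form, so that no sum and integral are
  interchanged here.\<close>

lemma periodization_integral:
  fixes \<psi> :: "real \<Rightarrow> complex"
  assumes cont: "continuous_on UNIV \<psi>"
  shows "(\<Sum>n\<in>{-int N..int N}. integral {-1/2..1/2} (\<lambda>x. \<psi> (x + of_int n)))
      = integral {- real N - 1/2..real N + 1/2} \<psi>"
proof -
  have int: "\<psi> integrable_on {a..b}" for a b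
    using cont by (intro integrable_continuous_real continuous_on_subset[OF cont]) auto
  have shift: "integral {-1/2..1/2} (\<lambda>x. \<psi> (x + of_int n)) = integral {of_int n - 1/2..of_int n
      + 1/2} \<psi>" for n
    using integral_shift_Icc_real[of "-1/2" "1/2" \<psi> "of_int n"] by (simp add: o_def add.commute)
  show ?thesis unfolding shift
  proof (induction N)
    case 0
    then show ?case by simp
  next
    case (Suc N)
    have "{-int (Suc N)..int (Suc N)} = insert (- int N - 1) (insert (int N
        + 1) {-int N..int N})" by auto
    hence "(\<Sum>n\<in>{-int (Suc N)..int (Suc N)}. integral {of_int n - 1/2..of_int n + 1/2} \<psi>) =
        integral {- real N - 3/2..- real N - 1/2} \<psi> + integral {- real N - 1/2..real N + 1/2} \<psi>
         + integral {real N + 1/2..real N + 3/2} \<psi>"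
      using Suc by (simp add: algebra_simps)
    also have "integral {- real N - 3/2..- real N - 1/2} \<psi> + integral {- real N - 1/2..real N + 1/2} \<psi>
        = integral {- real N - 3/2..real N + 1/2} \<psi>"
      by (intro Henstock_Kurzweil_Integration.integral_combine int) auto
    also have "\<dots> + integral {real N + 1/2..real N + 3/2} \<psi> = integral {- real N - 3/2..real N + 3/2} \<psi>"
      by (intro Henstock_Kurzweil_Integration.integral_combine int) auto
    finally show ?case by (simp add: algebra_simps)
  qed
qed

text \<open>Dominated convergence with majorant |\<psi>|; it also passes from the Henstock-Kurzweil
  integrals over intervals to the Lebesgue integral over the line.\<close>

lemma integral_symmetric_interval_tendsto:
  fixes \<psi> :: "real \<Rightarrow> complex"
  assumes int: "integrable lborel \<psi>"
  shows "(\<lambda>N. integral {- real N - 1/2..real N + 1/2} \<psi>) \<longlonglongrightarrow> (\<integral>x. \<psi> x \<partial>lborel)"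
proof -
  have "(\<lambda>N. \<integral>x. indicator {- real N - 1/2..real N + 1/2} x *\<^sub>R \<psi> x \<partial>lborel) \<longlonglongrightarrow> (\<integral>x. \<psi> x \<partial>lborel)"
  proof (rule integral_dominated_convergence)
    show "integrable lborel (\<lambda>x. norm (\<psi> x))" using int by simp
    show "AE x in lborel. (\<lambda>N. indicator {- real N - 1/2..real N + 1/2} x *\<^sub>R \<psi> x) \<longlonglongrightarrow> \<psi> x"
    proof (intro AE_I2 tendsto_eventually)
      fix x :: real
      show "\<forall>\<^sub>F N in sequentially. indicator {- real N - 1/2..real N + 1/2} x *\<^sub>R \<psi> x = \<psi> x"
        using eventually_ge_at_top[of "nat \<lceil>\<bar>x\<bar>\<rceil>"]
      proof eventually_elim
        case (elim N)
        hence "\<bar>x\<bar> \<le> real N" by linarith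
        hence "x \<in> {- real N - 1/2..real N + 1/2}" by auto
        thus ?case by simp
      qed
    qed
  qed (use int in \<open>auto simp: indicator_def\<close>)
  moreover have "(\<integral>x. indicator {- real N - 1/2..real N + 1/2} x *\<^sub>R \<psi> x \<partial>lborel)
      = integral {- real N - 1/2..real N + 1/2} \<psi>" for N
  proof -
    have "set_integrable lborel {- real N - 1/2..real N + 1/2} \<psi>"
      unfolding set_integrable_def using int by (intro integrable_mult_indicator) auto
    from set_borel_integral_eq_integral(2)[OF this] show ?thesis
      unfolding set_lebesgue_integral_def .
  qed
  ultimately show ?thesis by simp
qed

text \<open>The periodized Gaussian, the sum over n of exp(-pi t (z + n + a)^2), is entire in z. The
  left side is its value at 0 and the right side is the sum of its Fourier coefficients, so the
  Fourier series at 0 gives the claim.\<close>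

lemma jtheta_poisson_real:
  fixes t a :: real
  assumes t: "t > 0"
  shows "exp (- of_real (pi * t * a ^ 2)) * jtheta (- of_real (pi * t)) (- of_real (2 * pi * t * a)) =
           of_real (1 / sqrt t) * jtheta (- of_real (pi / t)) (2 * of_real pi * \<i> * of_real a)"
proof -
  define \<alpha> where "\<alpha> = - complex_of_real (pi * t)"
  \<comment> \<open>Expansion of the square \<alpha> (z + a + n)^2: \<open>\<beta> z\<close> is the
    coefficient of n, and \<open>g\<close> below collects the part without n.\<close>
  define \<beta> where "\<beta> = (\<lambda>z. - (2 * of_real (pi * t) * (z + of_real a)) :: complex)"
  define g where "g = (\<lambda>z. exp (\<alpha> * (z + of_real a) ^ 2) :: complex)"
  define f where "f = (\<lambda>z. g z * jtheta \<alpha> (\<beta> z))"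
  have \<alpha>: "Re \<alpha> < 0" using t by (simp add: \<alpha>_def)
  have f: "f holomorphic_on UNIV" unfolding f_def g_def \<beta>_def
    by (intro holomorphic_intros jtheta_holomorphic) (use \<alpha> in auto)
  define E where "E = (\<lambda>(k::int) (x::real). exp (- (2 * of_real pi * \<i> * of_int k
      * of_real x)) :: complex)"
  define \<psi> where "\<psi> = (\<lambda>k (x::real). exp (- of_real (pi * t * (x + a) ^ 2) - 2 * of_real pi * \<i>
      * of_int k * of_real x) :: complex)"
  define ck where "ck = (\<lambda>k::int. of_real (1 / sqrt t) * exp (- of_real (pi * of_int k ^ 2 / t) + 2
      * of_real pi * \<i> * of_int k * of_real a) :: complex)"
  have coeff: "integral {-1/2..1/2} (\<lambda>x. f (of_real x) * E k x) = ck k" for k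
  proof -
    let ?S = "\<lambda>(N::nat) (x::real). \<Sum>n\<in>{-int N..int N}. exp (\<alpha> * of_int n ^ 2 + \<beta> (of_real x) * of_int n)"
    have cont: "continuous_on {-1/2..1/2} (\<lambda>x. g (of_real x) * E k x)"
      unfolding g_def E_def by (intro continuous_intros)
    have ul: "uniform_limit {-1/2..1/2} ?S (\<lambda>x. jtheta \<alpha> (\<beta> (of_real x))) sequentially"
      by (rule filterlim_compose[OF jtheta_uniform_limit filterlim_symmetric_int_interval])
         (use \<alpha> in \<open>auto simp: \<beta>_def intro!: continuous_intros\<close>)
    have cont_j: "continuous_on {-1/2..1/2} (\<lambda>x. jtheta \<alpha> (\<beta> (of_real x)))"
      by (rule uniform_limit_theorem[OF _ ul]) (auto simp: \<beta>_def intro!: always_eventually continuous_intros)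
    have ul2: "uniform_limit {-1/2..1/2} (\<lambda>N x. (g (of_real x) * E k x)
        * ?S N x) (\<lambda>x. (g (of_real x) * E k x) * jtheta \<alpha> (\<beta> (of_real x))) sequentially"
      by (intro uniform_lim_mult uniform_limit_const ul compact_imp_bounded compact_continuous_image cont cont_j) auto
    have term_eq: "(g (of_real x) * E k x) * ?S N x = (\<Sum>n\<in>{-int N..int N}. \<psi> k (x + of_int n))" for N x
      unfolding sum_distrib_left
    proof (rule sum.cong[OF refl])
      fix n :: int
      \<comment> \<open>This factor 1 replaces e^(-2 pi i k x) by e^(-2 pi i k (x + n)), which makes
        the summand a function of x + n alone.\<close>
      have "exp (- (2 * of_real pi * \<i> * of_int k * of_int n)) = (1::complex)"
        unfolding exp_eq_1 by (auto intro!: exI[of _ "- k * n"])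
      hence "g (of_real x) * E k x * exp (\<alpha> * of_int n ^ 2 + \<beta> (of_real x) * of_int n) =
        g (of_real x) * E k x * exp (\<alpha> * of_int n ^ 2 + \<beta> (of_real x) * of_int n) * exp (- (2
            * of_real pi * \<i> * of_int k * of_int n))" by simp
      also have "\<dots> = \<psi> k (x + of_int n)"
        unfolding g_def E_def \<alpha>_def \<beta>_def \<psi>_def exp_add[symmetric]
        by (rule arg_cong[of _ _ exp]) (simp add: power2_eq_square algebra_simps)
      finally show "g (of_real x) * E k x * exp (\<alpha> * of_int n ^ 2 + \<beta> (of_real x) * of_int n)
          = \<psi> k (x + of_int n)" .
    qed
    have cont_\<psi>: "continuous_on UNIV (\<psi> k)" unfolding \<psi>_def by (intro continuous_intros)
    obtain I J where IJ: "\<And>N. ((\<lambda>x. (g (of_real x) * E k x) * ?S N x) has_integral I N) {-1/2..1/2}"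
       "((\<lambda>x. (g (of_real x) * E k x) * jtheta \<alpha> (\<beta> (of_real x))) has_integral J) {-1/2..1/2}" "I \<longlonglongrightarrow> J"
    proof (rule uniform_limit_integral[OF ul2])
      show "continuous_on {-1/2..1/2} (\<lambda>x. (g (of_real x) * E k x) * ?S N x)" for N
        unfolding \<beta>_def by (intro continuous_intros cont)
    qed auto
    have "I N = integral {- real N - 1/2..real N + 1/2} (\<psi> k)" for N
    proof -
      have "I N = integral {-1/2..1/2} (\<lambda>x. \<Sum>n\<in>{-int N..int N}. \<psi> k (x + of_int n))"
        using IJ(1)[of N] unfolding term_eq by (simp add: integral_unique)
      also have "\<dots> = (\<Sum>n\<in>{-int N..int N}. integral {-1/2..1/2} (\<lambda>x. \<psi> k (x + of_int n)))"
        by (intro Henstock_Kurzweil_Integration.integral_sum integrable_continuous_real continuous_on_compose2[OF cont_\<psi>] continuous_intros) auto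
      finally show ?thesis unfolding periodization_integral[OF cont_\<psi>] .
    qed
    hence I_eq: "I = (\<lambda>N. integral {- real N - 1/2..real N + 1/2} (\<psi> k))" by blast
    have "I \<longlonglongrightarrow> ck k"
      using integral_symmetric_interval_tendsto[OF gaussian_fourier(1)[OF t, of a k]] gaussian_fourier(2)[OF t, of a k]
      unfolding I_eq \<psi>_def ck_def by (simp only:)
    with IJ(3) have "J = ck k" using LIMSEQ_unique by blast
    with IJ(2) show ?thesis unfolding f_def by (simp add: integral_unique mult_ac)
  qed
  have "(\<lambda>N. \<Sum>k\<in>{-int N..int N}. ck k) \<longlonglongrightarrow> f 0"
    using fourier_series_at_0[OF f] coeff unfolding E_def by simp
  moreover have "(ck has_sum (of_real (1 / sqrt t) * jtheta (- of_real (pi / t)) (2 * of_real pi * \<i>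
      * of_real a))) UNIV"
  proof -
    have ck_eq: "ck = (\<lambda>k. of_real (1 / sqrt t) * exp (- of_real (pi / t) * of_int k ^ 2 + 2
        * of_real pi * \<i> * of_real a * of_int k))"
      unfolding ck_def by (simp add: mult_ac)
    show ?thesis unfolding ck_eq
      by (intro has_sum_cmult_right jtheta_has_sum) (use t in simp)
  qed
  hence "(\<lambda>N. \<Sum>k\<in>{-int N..int N}. ck k) \<longlonglongrightarrow> of_real (1 / sqrt t) * jtheta (- of_real (pi / t)) (2
      * of_real pi * \<i> * of_real a)"
    by (rule has_sum_int_imp_LIMSEQ)
  ultimately have "f 0 = of_real (1 / sqrt t) * jtheta (- of_real (pi / t)) (2 * of_real pi * \<i>
      * of_real a)"
    by (rule LIMSEQ_unique)
  thus ?thesis unfolding f_def g_def \<alpha>_def \<beta>_def by (simp add: mult.assoc)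
qed

text \<open>The identity theorem is applied in one variable at a time: for fixed positive real s the
  equation extends from real to complex w, and for fixed complex w from the positive real axis to
  the half-plane of s. There 1/s also has positive real part, so \<open>csqrt\<close> stays away
  from its cut.\<close>

theorem jtheta_transform:
  assumes s: "Re s > 0"
  shows "exp (- (of_real pi * s * w ^ 2)) * jtheta (- (of_real pi * s)) (- (2 * of_real pi * s * w)) =
           csqrt (1 / s) * jtheta (- (of_real pi / s)) (2 * of_real pi * \<i> * w)"
proof -
  define F where "F = (\<lambda>s w. exp (- (of_real pi * s * w ^ 2)) * jtheta (- (of_real pi * s)) (- (2
      * of_real pi * s * w)) -
           csqrt (1 / s) * jtheta (- (of_real pi / s)) (2 * of_real pi * \<i> * w))"
  have Re_inv: "Re (1 / s) > 0" if "Re s > 0" for s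
    using that by (simp add: Re_divide_of_real complex_div_gt_0 Re_complex_div_gt_0)
  have Re1: "Re (- (of_real pi / s)) < 0" "Re (- (of_real pi * s)) < 0" if "Re s > 0" for s
  proof -
    have "- (of_real pi / s) = of_real (- pi) * (1 / s)" by simp
    hence "Re (- (of_real pi / s)) = - pi * Re (1 / s)" by (simp only: Re_complex_of_real times_complex.sel Im_complex_of_real)
    thus "Re (- (of_real pi / s)) < 0" using Re_inv[OF that] by simp
    show "Re (- (of_real pi * s)) < 0" using that by simp
  qed
  have holw: "F s holomorphic_on UNIV" if "Re s > 0" for s
    unfolding F_def by (intro holomorphic_intros jtheta_holomorphic) (use Re1[OF that] in auto)
  have real: "F (of_real t) (of_real a) = 0" if "t > 0" for t a
  proof -
    have "csqrt (1 / of_real t) = csqrt (of_real (1 / t))" by simp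
    also have "\<dots> = of_real (1 / sqrt t)"
      using that by (subst csqrt_of_real_nonneg) (simp_all add: real_sqrt_divide)
    finally have c: "csqrt (1 / of_real t) = of_real (1 / sqrt t)" .
    show ?thesis
      using jtheta_poisson_real[OF that, of a] unfolding F_def c by (simp add: mult.assoc)
  qed
  have realt: "F (of_real t) w = 0" if "t > 0" for t w
  proof (rule analytic_continuation[of "F (of_real t)" UNIV \<real> 0])
    show "(0::complex) islimpt \<real>"
      unfolding islimpt_approachable
    proof (intro allI impI)
      fix e :: real assume "e > 0"
      thus "\<exists>x'\<in>\<real>. x' \<noteq> (0::complex) \<and> dist x' 0 < e"
        by (intro bexI[of _ "of_real (e/2)"]) auto
    qed
  qed (use holw that real in \<open>auto elim!: Reals_cases\<close>)
  have "F s w = 0"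
  proof (rule analytic_continuation[of "\<lambda>s. F s w" "{s. Re s > 0}" "of_real ` {0<..}" 1])
    have "s \<notin> \<real>\<^sub>\<le>\<^sub>0" if "Re s > 0" for s using that by (auto simp: complex_nonpos_Reals_iff)
    thus "(\<lambda>s. F s w) holomorphic_on {s. Re s > 0}"
      unfolding F_def
      by (intro holomorphic_intros jtheta_holomorphic) (use Re1 Re_inv open_halfspace_Re_gt in auto)
    show "open {s. Re s > 0}" by (rule open_halfspace_Re_gt)
    show "connected {s. Re s > 0}" by (intro convex_connected convex_halfspace_Re_gt)
    show "(1::complex) islimpt of_real ` {0<..}"
      unfolding islimpt_approachable
    proof (intro allI impI)
      fix e :: real assume "e > 0"
      thus "\<exists>x'\<in>of_real ` {0<..}. x' \<noteq> (1::complex) \<and> dist x' 1 < e"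
        by (intro bexI[OF _ imageI[of "1 + e / 2"]]) (auto simp: dist_norm)
    qed
  qed (use s realt in auto)
  thus ?thesis unfolding F_def by simp
qed

subsection \<open>The pentagonal number theorem\<close>

definition pent :: "int \<Rightarrow> nat" where
  "pent n = nat ((3 * n ^ 2 - n) div 2)"

text \<open>Doubling removes both the division and the truncation by \<open>nat\<close>: 3n^2 - n is
  even and non-negative for every integer n.\<close>

lemma pent_int: "int (pent n) * 2 = 3 * n ^ 2 - n"
proof -
  have nn: "3 * n ^ 2 - n \<ge> 0"
  proof (cases "n \<ge> 1")
    case True
    hence "n * 1 \<le> n * n" by (intro mult_left_mono) auto
    thus ?thesis using True by (simp add: power2_eq_square)
  next
    case False
    have "n ^ 2 \<ge> 0" by simp
    thus ?thesis using False by linarith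
  qed
  have "even (3 * n ^ 2 - n)" by simp
  hence "(3 * n ^ 2 - n) div 2 * 2 = 3 * n ^ 2 - n" by (rule dvd_div_mult_self)
  moreover have "(3 * n ^ 2 - n) div 2 \<ge> 0" using nn by simp
  ultimately show ?thesis unfolding pent_def by simp
qed

text \<open>Shanks's finite form of the pentagonal number theorem.\<close>
lemma shanks_identity:
  fixes q :: complex
  defines "P \<equiv> \<lambda>s. \<Prod>k<s. 1 - q * q ^ k"
  assumes nz: "\<And>s. P s \<noteq> 0"
  shows "(\<Sum>s\<le>n. (-1) ^ s * (P n / P s) * q ^ (s * n + (\<Sum>{..s}))) = (\<Sum>j\<in>{-int n..int n}. (-1) powi j
      * q ^ pent j)"
proof (induction n)
  case 0
  then show ?case using nz[of 0] by (simp add: pent_def)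
next
  case (Suc n)
  define T where "T = (\<lambda>s. \<Sum>{..s::nat})"
  have T_Suc: "T (Suc s) = T s + Suc s" for s by (simp add: T_def)
  have T2: "int (T s) * 2 = int s ^ 2 + int s" for s
    by (induction s) (auto simp: T_def power2_eq_square algebra_simps)
  have P_Suc: "P (Suc s) = P s * (1 - q * q ^ s)" for s by (simp add: P_def)
  have nzf: "1 - q * q ^ s \<noteq> 0" for s using nz[of "Suc s"] P_Suc[of s] by auto
  have half: "a = b" if "int a * 2 = int b * 2" for a b using that by simp
  define A where "A = (\<lambda>n s. (-1) ^ s * (P n / P s) * q ^ (s * n + T s))"
  \<comment> \<open>The differences between rows n + 1 and n telescope in s, leaving one boundary
    term for each upper limit m.\<close>
  have tele: "(\<Sum>s\<le>m. A (Suc n) s - A n s) = - ((-1) ^ m * (P n / P m) * q ^ (m * Suc n + Suc n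
      + T m))" for m
  proof (induction m)
    case 0
    show ?case using nz[of 0] by (simp add: A_def T_def P_Suc P_def algebra_simps)
  next
    case (Suc m)
    \<comment> \<open>Every term of the induction step is a multiple of X, and what remains is the
      identity -(1 - b) + 1 - (1 - a) b = a b with a = q^(n+1) and b = q^(m+1).\<close>
    define Y where "Y = P n / P (Suc m)"
    define X where "X = (-1) ^ m * Y * q ^ (m * Suc n + Suc n + T m)"
    have 1: "(-1) ^ m * (P n / P m) * q ^ (m * Suc n + Suc n + T m) = X * (1 - q * q ^ m)"
      unfolding X_def Y_def P_Suc using nz[of m] nzf[of m] by simp
    have 2: "A n (Suc m) = - X"
      unfolding A_def X_def T_Suc Y_def[symmetric] by (simp add: algebra_simps power_add)
    have 3: "A (Suc n) (Suc m) = - X * (1 - q * q ^ n) * (q * q ^ m)"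
    proof -
      have "P (Suc n) / P (Suc m) = Y * (1 - q * q ^ n)"
        unfolding Y_def P_Suc[of n] by (simp only: times_divide_eq_left)
      thus ?thesis
        unfolding A_def X_def T_Suc by (simp only:) (simp add: algebra_simps power_add)
    qed
    have 4: "- ((-1) ^ Suc m * (P n / P (Suc m)) * q ^ (Suc m * Suc n + Suc n + T (Suc m))) = X * (q
        * q ^ n) * (q * q ^ m)"
      unfolding X_def T_Suc Y_def[symmetric] by (simp add: algebra_simps power_add)
    show ?case unfolding 4 sum.atMost_Suc Suc 1 2 3 by (simp add: algebra_simps)
  qed
  \<comment> \<open>Passing from n to n + 1 adds two terms: the boundary term at m = n, which has
    exponent \<open>pent (n + 1)\<close>, and the new summand s = n + 1, which has exponent
    \<open>pent (- (n + 1))\<close>.\<close>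
  have "(\<Sum>s\<le>Suc n. A (Suc n) s) = (\<Sum>s\<le>n. A n s) + (\<Sum>s\<le>n. A (Suc n) s - A n s) + A (Suc n) (Suc n)"
    by (simp add: sum_subtractf)
  also have "(\<Sum>s\<le>n. A (Suc n) s - A n s) = (-1) ^ Suc n * q ^ (n * Suc n + Suc n + T n)"
    unfolding tele using nz[of n] by simp
  also have "A (Suc n) (Suc n) = (-1) ^ Suc n * q ^ (Suc n * Suc n + T (Suc n))"
    unfolding A_def using nz[of "Suc n"] by simp
  also have "n * Suc n + Suc n + T n = pent (int (Suc n))"
  proof -
    have "int (n * Suc n + Suc n + T n) * 2 = int (pent (int (Suc n))) * 2"
      unfolding pent_int using T2[of "n"] by (simp add: power2_eq_square algebra_simps)
    thus ?thesis by (rule half)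
  qed
  also have "Suc n * Suc n + T (Suc n) = pent (- int (Suc n))"
  proof -
    have "int (Suc n * Suc n + T (Suc n)) * 2 = int (pent (- int (Suc n))) * 2"
      unfolding pent_int using T2[of "Suc n"] by (simp add: power2_eq_square algebra_simps)
    thus ?thesis by (rule half)
  qed
  also have "(\<Sum>s\<le>n. A n s) = (\<Sum>j\<in>{-int n..int n}. (-1) powi j * q ^ pent j)"
    using Suc unfolding A_def T_def .
  finally have "(\<Sum>s\<le>Suc n. A (Suc n) s) = (\<Sum>j\<in>{-int n..int n}. (-1) powi j * q ^ pent j)
     + (-1) ^ Suc n * q ^ pent (int (Suc n)) + (-1) ^ Suc n * q ^ pent (- int (Suc n))" .
  also have "\<dots> = (\<Sum>j\<in>{-int (Suc n)..int (Suc n)}. (-1) powi j * q ^ pent j)"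
  proof -
    have "{-int (Suc n)..int (Suc n)} = insert (- int (Suc n)) (insert (int (Suc n)) {-int n..int n})" by auto
    hence "(\<Sum>j\<in>{-int (Suc n)..int (Suc n)}. (-1) powi j * q ^ pent j) =
       (-1) powi (- int (Suc n)) * q ^ pent (- int (Suc n)) + ((-1) powi (int (Suc n))
           * q ^ pent (int (Suc n)) +
        (\<Sum>j\<in>{-int n..int n}. (-1) powi j * q ^ pent j))"
      by (simp only:) simp
    moreover have "(-1 :: complex) powi (- int (Suc n))
        = (-1) ^ Suc n" "(-1 :: complex) powi (int (Suc n)) = (-1) ^ Suc n"
      by (simp_all only: power_int_minus power_int_of_nat) (metis power_inverse inverse_minus_eq inverse_1)
    ultimately show ?thesis by (simp only: add_ac)
  qed
  finally show ?case unfolding A_def T_def .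
qed

text \<open>Let n tend to infinity in Shanks's identity. The summand s = 0 is the partial product P
  n, and the other n summands are each O(|q|^n), so their sum vanishes in the limit.\<close>

lemma pentagonal_number_theorem:
  assumes q: "norm q < 1" and S: "((\<lambda>j. (-1) powi j * q ^ pent j) has_sum S) UNIV"
  shows "qpoch_inf q q = S"
proof -
  define P where "P = (\<lambda>s. \<Prod>k<s. 1 - q * q ^ k)"
  have nz: "P s \<noteq> 0" for s unfolding P_def using euler_factor_nonzero[OF q] by (simp add: prod_zero_iff)
  have P_lim: "P \<longlonglongrightarrow> qpoch_inf q q"
    unfolding P_def qpoch_inf_def
    by (rule has_prod_imp_tendsto'[OF convergent_prod_has_prod[OF convergent_prod_euler[OF q]]])
  have "Bseq P" using P_lim by (intro convergent_imp_Bseq) (auto simp: convergent_def)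
  then obtain M where M: "\<And>n. norm (P n) \<le> M" "M > 0" unfolding Bseq_def by blast
  \<comment> \<open>The infinite product is nonzero, hence the reciprocals of the partial products
    are bounded too.\<close>
  have "(\<lambda>n. inverse (P n)) \<longlonglongrightarrow> inverse (qpoch_inf q q)"
    using P_lim qpoch_inf_euler_nonzero[OF q] by (intro tendsto_inverse)
  hence "Bseq (\<lambda>n. inverse (P n))" by (intro convergent_imp_Bseq) (auto simp: convergent_def)
  then obtain L where L: "\<And>n. norm (inverse (P n)) \<le> L" "L > 0" unfolding Bseq_def by blast
  define G where "G = (\<lambda>n. \<Sum>s\<le>n. (-1) ^ s * (P n / P s) * q ^ (s * n + (\<Sum>{..s})))"
  have bound: "norm (G n - P n) \<le> M * L * (real n * norm q ^ n)" for n
  proof -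
    have "G n = P n + (\<Sum>s\<in>{1..n}. (-1) ^ s * (P n / P s) * q ^ (s * n + (\<Sum>{..s})))"
    proof -
      have "{..n} = insert 0 {1..n}" by auto
      thus ?thesis unfolding G_def by (simp add: P_def)
    qed
    hence "norm (G n - P n) = norm (\<Sum>s\<in>{1..n}. (-1) ^ s * (P n / P s) * q ^ (s * n + (\<Sum>{..s})))" by simp
    also have "\<dots> \<le> (\<Sum>s\<in>{1..n}. M * L * norm q ^ n)"
    proof (rule sum_norm_le)
      fix s assume s: "s \<in> {1..n}"
      have "norm ((-1) ^ s * (P n / P s) * q ^ (s * n + (\<Sum>{..s}))) = norm (P n)
          * norm (inverse (P s)) * norm q ^ (s * n + (\<Sum>{..s}))"
        by (simp add: norm_mult norm_power divide_inverse norm_inverse)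
      moreover have "n \<le> s * n + \<Sum>{..s}"
        using s by (cases s) auto
      hence "norm (P n) * norm (inverse (P s)) * norm q ^ (s * n + (\<Sum>{..s})) \<le> M * L * norm q ^ n"
        using M L q s by (intro mult_mono power_decreasing) auto
      ultimately show "norm ((-1) ^ s * (P n / P s) * q ^ (s * n + (\<Sum>{..s}))) \<le> M * L
          * norm q ^ n" by simp
    qed
    finally show ?thesis by (simp add: mult_ac)
  qed
  have "(\<lambda>n. real n * norm q ^ n) \<longlonglongrightarrow> 0"
    using q by (intro powser_times_n_limit_0) auto
  hence "(\<lambda>n. M * L * (real n * norm q ^ n)) \<longlonglongrightarrow> 0" by (rule tendsto_mult_right_zero)
  hence "(\<lambda>n. G n - P n) \<longlonglongrightarrow> 0"
    by (rule Lim_null_comparison[rotated]) (use bound in auto)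
  hence "G \<longlonglongrightarrow> qpoch_inf q q" using Lim_transform P_lim by blast
  moreover have "G \<longlonglongrightarrow> S"
    using has_sum_int_imp_LIMSEQ[OF S] shanks_identity[of q] nz unfolding G_def P_def by simp
  ultimately show ?thesis by (rule LIMSEQ_unique)
qed

subsection \<open>The eta function under the Fricke involution\<close>

lemma exp_eq_of_2pi_multiple:
  assumes "x = y + 2 * of_int k * of_real pi * \<i>"
  shows "exp x = exp y"
  unfolding exp_eq using assms by (intro exI[of _ k]) simp

lemma jtheta_2pi_periodic: "jtheta \<alpha> (\<beta> + 2 * of_real pi * \<i>) = jtheta \<alpha> \<beta>"
  unfolding jtheta_def
  by (intro infsum_cong exp_eq_of_2pi_multiple) (simp add: algebra_simps)

lemma powi_neg1_eq_exp: "(-1 :: complex) powi n = exp (of_real pi * \<i> * of_int n)"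
  using exp_power_int[of "of_real pi * \<i>" n] exp_pi_i by (simp add: mult_ac)

lemma nome_powi_half:
  assumes "even m"
  shows "nome \<tau> powi (m div 2) = exp (of_real pi * \<i> * \<tau> * of_int m)"
proof -
  obtain k where "m = 2 * k" using assms by blast
  thus ?thesis unfolding nome_def exp_power_int by (simp add: mult_ac)
qed

lemma norm_nome_less_1: "Im \<tau> > 0 \<Longrightarrow> norm (nome \<tau>) < 1"
  by (simp add: nome_def)

lemma Im_fricke5_pos: "Im \<tau> > 0 \<Longrightarrow> Im (fricke5 \<tau>) > 0"
  by (auto simp: fricke5_def Im_divide complex_eq_iff intro!: divide_pos_pos add_nonneg_pos)

lemma qpoch_inf_nome_eq_jtheta:
  assumes "Im \<tau> > 0"
  shows "qpoch_inf (nome \<tau>) (nome \<tau>) = jtheta (3 * of_real pi * \<i> * \<tau>) (of_real pi * \<i> - of_real pi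
      * \<i> * \<tau>)"
proof (rule pentagonal_number_theorem[OF norm_nome_less_1[OF assms]])
  have "(-1) powi j * nome \<tau> ^ pent j =
          exp (3 * of_real pi * \<i> * \<tau> * of_int j ^ 2 + (of_real pi * \<i> - of_real pi * \<i> * \<tau>)
              * of_int j)" for j
  proof -
    have "nome \<tau> ^ pent j = exp (of_real pi * \<i> * \<tau> * of_int (int (pent j) * 2))"
      unfolding nome_def exp_of_nat_mult[symmetric] by (simp add: mult_ac)
    thus ?thesis
      unfolding pent_int powi_neg1_eq_exp exp_add[symmetric] by (simp add: algebra_simps flip: exp_add)
  qed
  thus "((\<lambda>j. (-1) powi j * nome \<tau> ^ pent j) has_sum
      jtheta (3 * of_real pi * \<i> * \<tau>) (of_real pi * \<i> - of_real pi * \<i> * \<tau>)) UNIV"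
    using jtheta_has_sum[of "3 * of_real pi * \<i> * \<tau>"] assms by simp
qed

text \<open>The exponent on the left is a multiple of (n + 1/2)^2. For n = 3m + r with r = 0, -1, 1
  it becomes a multiple of (m + c)^2 with c = 1/6, -1/6, 1/2, and the character e^(pi i n/3) becomes
  (-1)^m up to a constant. The shifts 1/6 and -1/6 are exchanged by m to -m and give the pentagonal
  series; the shift 1/2 gives zero.\<close>

lemma jtheta_split_mod3:
  assumes "Im \<tau> > 0"
  shows "jtheta (of_real pi * \<i> * \<tau> / 3) (of_real pi * \<i> * \<tau> / 3 + of_real pi * \<i> / 3) =
           (1 + exp (- (of_real pi * \<i> / 3))) * jtheta (3 * of_real pi * \<i> * \<tau>) (of_real pi
               * \<i> - of_real pi * \<i> * \<tau>)"
    (is "_ = _ * ?D")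
proof -
  define \<alpha> where "\<alpha> = 3 * of_real pi * \<i> * \<tau>"
  have \<alpha>: "Re \<alpha> < 0" using assms by (simp add: \<alpha>_def)
  have \<alpha>3: "Re (of_real pi * \<i> * \<tau> / 3) < 0" using assms by simp
  define f where "f = (\<lambda>n::int. exp (of_real pi * \<i> * \<tau> / 3 * of_int n ^ 2 + (of_real pi * \<i> * \<tau> / 3
      + of_real pi * \<i> / 3) * of_int n))"
  have f: "(f has_sum jtheta (of_real pi * \<i> * \<tau> / 3) (of_real pi * \<i> * \<tau> / 3 + of_real pi
      * \<i> / 3)) UNIV"
    unfolding f_def by (rule jtheta_has_sum[OF \<alpha>3])
  have part: "(f has_sum (c * jtheta \<alpha> \<beta>)) (range (\<lambda>m. 3 * m + r))"
    if "\<And>m. f (3 * m + r) = c * exp (\<alpha> * of_int m ^ 2 + \<beta> * of_int m)" for c \<beta> r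
  proof -
    have inj: "inj (\<lambda>m::int. 3 * m + r)" by (auto simp: inj_def)
    show ?thesis
      unfolding has_sum_reindex[OF inj] o_def that by (intro has_sum_cmult_right jtheta_has_sum \<alpha>)
  qed
  have D: "jtheta \<alpha> (of_real pi * \<i> + of_real pi * \<i> * \<tau>) = ?D"
  proof -
    have "jtheta \<alpha> (of_real pi * \<i> + of_real pi * \<i> * \<tau>) = jtheta \<alpha> (- (of_real pi * \<i> + of_real pi
        * \<i> * \<tau>) + 2 * of_real pi * \<i>)"
      unfolding jtheta_2pi_periodic by (rule jtheta_minus[symmetric])
    also have "- (of_real pi * \<i> + of_real pi * \<i> * \<tau>) + 2 * of_real pi * \<i> = of_real pi
        * \<i> - of_real pi * \<i> * \<tau>"
      by simp
    finally show ?thesis unfolding \<alpha>_def .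
  qed
  have 0: "(f has_sum (1 * jtheta \<alpha> (of_real pi * \<i> + of_real pi * \<i> * \<tau>))) (range (\<lambda>m. 3 * m + 0))"
    by (rule part) (simp add: f_def \<alpha>_def power2_eq_square algebra_simps)
  \<comment> \<open>The representative -1 instead of 2 yields the pentagonal series without a shift
    of m.\<close>
  have 1: "(f has_sum (exp (- (of_real pi * \<i> / 3)) * ?D)) (range (\<lambda>m. 3 * m + (-1)))"
    unfolding \<alpha>_def[symmetric]
    by (rule part) (simp add: f_def \<alpha>_def power2_eq_square algebra_simps diff_divide_distrib add_divide_distrib flip: exp_add)
  have 2: "(f has_sum (exp (2 * of_real pi * \<i> * \<tau> / 3 + of_real pi * \<i> / 3) * jtheta \<alpha> (\<alpha>
      + of_real pi * \<i>))) (range (\<lambda>m. 3 * m + 1))"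
    by (rule part) (simp add: f_def \<alpha>_def power2_eq_square algebra_simps diff_divide_distrib add_divide_distrib flip: exp_add)
  \<comment> \<open>The terms for \<open>m\<close> and \<open>- m - 1\<close> cancel.\<close>
  have z: "jtheta \<alpha> (\<alpha> + of_real pi * \<i>) = 0"
  proof -
    have 1: "jtheta \<alpha> (- \<alpha> + of_real pi * \<i>) = exp (of_real pi * \<i>) * jtheta \<alpha> (\<alpha> + of_real pi * \<i>)"
      using jtheta_period[OF \<alpha>, of "- \<alpha> + of_real pi * \<i>"] by (simp add: algebra_simps)
    have 2: "jtheta \<alpha> (- \<alpha> + of_real pi * \<i>) = jtheta \<alpha> (- (- \<alpha> + of_real pi * \<i>) + 2 * of_real pi * \<i>)"
      unfolding jtheta_2pi_periodic by (rule jtheta_minus[symmetric])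
    have "- (- \<alpha> + of_real pi * \<i>) + 2 * of_real pi * \<i> = \<alpha> + of_real pi * \<i>" by simp
    hence "jtheta \<alpha> (\<alpha> + of_real pi * \<i>) = - jtheta \<alpha> (\<alpha> + of_real pi * \<i>)"
      using 1 2 by (metis exp_pi_i' mult_minus1 mult.commute)
    thus ?thesis by simp
  qed
  have "(f has_sum (?D + exp (- (of_real pi * \<i> / 3)) * ?D + 0))
      ((range (\<lambda>m. 3 * m + 0) \<union> range (\<lambda>m. 3 * m + (-1))) \<union> range (\<lambda>m. 3 * m + 1))"
    using 0 1 2 unfolding D z by (intro has_sum_Un_disjoint) (auto simp: image_iff, presburger+)
  also have "(range (\<lambda>m::int. 3 * m + 0) \<union> range (\<lambda>m. 3 * m + (-1))) \<union> range (\<lambda>m. 3 * m + 1) = UNIV"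
  proof -
    have "\<exists>m. x = 3 * m + 0 \<or> x = 3 * m + (-1) \<or> x = 3 * m + 1" for x :: int by presburger
    thus ?thesis unfolding set_eq_iff Un_iff image_iff by blast
  qed
  finally show ?thesis using has_sum_unique[OF f] by (simp add: algebra_simps)
qed

section \<open>Dedekind's eta function and its power -3/5\<close>

definition eta :: "complex \<Rightarrow> complex" where
  "eta \<tau> = exp (of_real pi * \<i> * \<tau> / 12) * qpoch_inf (nome \<tau>) (nome \<tau>)"

lemma eta_nonzero: "Im \<tau> > 0 \<Longrightarrow> eta \<tau> \<noteq> 0"
  using qpoch_inf_euler_nonzero norm_nome_less_1 by (simp add: eta_def)

text \<open>The constant on the right is 2 cos(pi/6) = sqrt 3, which also splits off the square root
  on the left, so this is the classical law for eta under -1/\<tau>.\<close>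

lemma eta_transform:
  assumes "Im \<tau> > 0"
  shows "csqrt (3 * \<i> / \<tau>) * eta (- 1 / \<tau>) =
    exp (of_real pi * \<i> / 6) * (1 + exp (- (of_real pi * \<i> / 3))) * eta \<tau>"
proof -
  have nz: "\<tau> \<noteq> 0" using assms by auto
  have Im': "Im (- 1 / \<tau>) > 0" using assms nz
    by (auto simp: Im_divide complex_eq_iff intro!: divide_pos_pos add_nonneg_pos)
  \<comment> \<open>Chosen so that the dual side of \<open>jtheta_transform\<close> is the
    pentagonal series at -1/\<tau>: \<open>s\<close> fits its quadratic coefficient and
    \<open>w\<close> its linear one. The other side is then the series split modulo 3.\<close>
  define s where "s = - \<i> * \<tau> / 3"
  define w where "w = 1 / 2 + 1 / (2 * \<tau>)"
  have Re_s: "Re s > 0" using assms by (simp add: s_def)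
  have 1: "- (of_real pi * s * w ^ 2) = of_real pi * \<i> * \<tau> / 12 + of_real pi * \<i> / 6 + of_real pi
      * \<i> / (12 * \<tau>)"
    using nz by (simp add: s_def w_def power2_eq_square field_simps)
  have 2: "- (of_real pi * s) = of_real pi * \<i> * \<tau> / 3" by (simp add: s_def)
  have 3: "- (2 * of_real pi * s * w) = of_real pi * \<i> * \<tau> / 3 + of_real pi * \<i> / 3"
    using nz by (simp add: s_def w_def field_simps)
  have 4: "- (of_real pi / s) = 3 * of_real pi * \<i> * (- 1 / \<tau>)" "1 / s = 3 * \<i> / \<tau>"
    using nz by (simp_all add: s_def field_simps)
  have 5: "2 * of_real pi * \<i> * w = of_real pi * \<i> - of_real pi * \<i> * (- 1 / \<tau>)"
    using nz by (simp add: w_def field_simps)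
  have T: "csqrt (3 * \<i> / \<tau>) * qpoch_inf (nome (- 1 / \<tau>)) (nome (- 1 / \<tau>)) =
      exp (of_real pi * \<i> * \<tau> / 12 + of_real pi * \<i> / 6 + of_real pi * \<i> / (12 * \<tau>)) *
        ((1 + exp (- (of_real pi * \<i> / 3))) * qpoch_inf (nome \<tau>) (nome \<tau>))"
    using jtheta_transform[OF Re_s, of w] unfolding 1 2 3 4 5 jtheta_split_mod3[OF assms]
      qpoch_inf_nome_eq_jtheta[OF Im', symmetric] qpoch_inf_nome_eq_jtheta[OF assms, symmetric] by simp
  \<comment> \<open>The factor q^(1/24) at -1/\<tau> cancels the term with 1/\<tau> left by
    completing the square.\<close>
  have X: "exp (of_real pi * \<i> * (- 1 / \<tau>) / 12) *
     exp (of_real pi * \<i> * \<tau> / 12 + of_real pi * \<i> / 6 + of_real pi * \<i> / (12 * \<tau>)) =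
     exp (of_real pi * \<i> * \<tau> / 12) * exp (of_real pi * \<i> / 6)"
    unfolding exp_add[symmetric] by (simp add: field_simps)
  have "csqrt (3 * \<i> / \<tau>) * eta (- 1 / \<tau>) = exp (of_real pi * \<i> * (- 1 / \<tau>) / 12) *
      (csqrt (3 * \<i> / \<tau>) * qpoch_inf (nome (- 1 / \<tau>)) (nome (- 1 / \<tau>)))"
    unfolding eta_def by (rule mult.left_commute)
  thus ?thesis unfolding T mult.assoc[symmetric] X unfolding eta_def by (simp only: mult_ac)
qed

text \<open>\<open>\<eta>(\<tau>)\<^sup>-\<^sup>3\<^sup>/\<^sup>5\<close>: the exponent \<open>1/20\<close> is \<open>1/12 * 3/5\<close>.\<close>
definition eta_pow :: "complex \<Rightarrow> complex" where
  "eta_pow \<tau> = exp (- (of_real pi * \<i> * \<tau> / 20)) * euler_pow (nome \<tau>)"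

lemma eta_pow_power5:
  assumes "Im \<tau> > 0"
  shows "eta_pow \<tau> ^ 5 = inverse (eta \<tau> ^ 3)"
proof -
  have "euler_pow (nome \<tau>) ^ 5 = inverse (qpoch_inf (nome \<tau>) (nome \<tau>) ^ 3)"
    using is_euler_branch_euler_pow norm_nome_less_1[OF assms] by (simp add: is_euler_branch_def)
  moreover have "exp (- (of_real pi * \<i> * \<tau> / 20)) ^ 5 = inverse (exp (of_real pi * \<i> * \<tau> / 12) ^ 3)"
    by (simp flip: exp_of_nat_mult exp_minus)
  ultimately show ?thesis
    by (simp add: eta_pow_def eta_def power_mult_distrib)
qed

lemma eta_pow_nonzero: "Im \<tau> > 0 \<Longrightarrow> eta_pow \<tau> \<noteq> 0"
  using eta_pow_power5[of \<tau>] eta_nonzero[of \<tau>] by auto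

lemma continuous_on_eta_pow: "continuous_on {\<tau>. Im \<tau> > 0} eta_pow"
proof -
  have "euler_pow holomorphic_on ball 0 1" using is_euler_branch_euler_pow by (simp add: is_euler_branch_def)
  hence "continuous_on {\<tau>. Im \<tau> > 0} (\<lambda>\<tau>. euler_pow (nome \<tau>))"
    by (rule continuous_on_compose2[OF holomorphic_on_imp_continuous_on])
       (use norm_nome_less_1 in \<open>auto simp: nome_def[abs_def] intro!: continuous_intros\<close>)
  thus ?thesis unfolding eta_pow_def by (intro continuous_intros) auto
qed

lemma fifth_root_power5: "z \<noteq> 0 \<Longrightarrow> fifth_root z ^ 5 = z"
proof -
  assume z: "z \<noteq> 0"
  have "fifth_root z ^ 5 = of_real (root 5 (norm z) ^ 5) * exp (of_nat 5 * (\<i> * of_real (Arg2pi z / 5)))"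
    unfolding fifth_root_eq[OF z] by (simp only: power_mult_distrib exp_of_nat_mult of_real_power)
  thus ?thesis using Arg2pi_eq[of z] by (simp add: real_root_pow_pos2)
qed

text \<open>\<open>Arg2pi\<close> jumps only across the non-negative real axis, which the upper
  half-plane avoids.\<close>

lemma continuous_on_fifth_root: "continuous_on {\<tau>. Im \<tau> > 0} fifth_root"
proof -
  have "continuous_on {\<tau>. Im \<tau> > 0} Arg2pi"
    by (intro continuous_at_imp_continuous_on ballI continuous_at_Arg2pi)
       (auto simp: complex_nonneg_Reals_iff)
  hence "continuous_on {\<tau>. Im \<tau> > 0} (\<lambda>z. of_real (root 5 (norm z)) * exp (\<i> * of_real (Arg2pi z / 5)))"
    by (intro continuous_intros) auto
  moreover have "of_real (root 5 (norm z)) * exp (\<i> * of_real (Arg2pi z / 5)) = fifth_root z"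
    if "z \<in> {\<tau>. Im \<tau> > 0}" for z
    by (rule fifth_root_eq[symmetric]) (use that in auto)
  ultimately show ?thesis by (subst (asm) continuous_on_cong[OF refl]) auto
qed

text \<open>The tenth power of the quotient is constant, so the quotient is a continuous function with
  finitely many values.\<close>
lemma eta_pow_fricke5:
  "\<exists>\<kappa>. \<forall>\<tau>. Im \<tau> > 0 \<longrightarrow> eta_pow (fricke5 \<tau>) = \<kappa> * (fifth_root \<tau> * csqrt (\<i> / \<tau>) * eta_pow (5 * \<tau>))"
proof -
  let ?U = "{\<tau>. Im \<tau> > 0}"
  define c where "c = exp (of_real pi * \<i> / 6) * (1 + exp (- (of_real pi * \<i> / 3)))"
  \<comment> \<open>The expected factor has weight -3/10 = 1/5 - 1/2. It is written as a fifth root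
    times \<open>csqrt (\<i> / \<tau>)\<close> because exactly this square root occurs in the
    transformation of the theta series.\<close>
  define Q where "Q = (\<lambda>\<tau>. fifth_root \<tau> * csqrt (\<i> / \<tau>) * eta_pow (5 * \<tau>))"
  define R where "R = (\<lambda>\<tau>. eta_pow (fricke5 \<tau>) / Q \<tau>)"
  have Q_nz: "Q \<tau> \<noteq> 0" if "\<tau> \<in> ?U" for \<tau>
  proof -
    have "\<tau> \<noteq> 0" using that by auto
    hence "fifth_root \<tau> \<noteq> 0" using fifth_root_power5[of \<tau>] by auto
    with that show ?thesis using eta_pow_nonzero[of "5 * \<tau>"] by (auto simp: Q_def)
  qed
  \<comment> \<open>The power 10 turns \<open>eta_pow\<close> into eta^(-6), where the square root
    of the eta law appears to the sixth power; both exponents are even, so no root survives.\<close>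
  have csqrt_pow: "csqrt z ^ 6 = z ^ 3" "csqrt z ^ 10 = z ^ 5" for z
    using power_mult[of "csqrt z" 2 3] power_mult[of "csqrt z" 2 5] by simp_all
  have R10: "R \<tau> ^ 10 = (3 / 5) ^ 3 / (c ^ 6 * \<i> ^ 2)" if \<tau>: "\<tau> \<in> ?U" for \<tau>
  proof -
    have nz: "\<tau> \<noteq> 0" using \<tau> by auto
    have e: "csqrt (3 * \<i> / (5 * \<tau>)) * eta (fricke5 \<tau>) = c * eta (5 * \<tau>)"
      using eta_transform[of "5 * \<tau>"] \<tau> by (simp add: c_def fricke5_def)
    have n1: "eta (fricke5 \<tau>) \<noteq> 0" and n2: "eta (5 * \<tau>) \<noteq> 0"
      using \<tau> Im_fricke5_pos by (auto intro!: eta_nonzero)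
    have "c \<noteq> 0" using e n1 nz by auto
    have "(csqrt (3 * \<i> / (5 * \<tau>)) * eta (fricke5 \<tau>)) ^ 6 = (c * eta (5 * \<tau>)) ^ 6" unfolding e ..
    hence e6: "(3 * \<i> / (5 * \<tau>)) ^ 3 * eta (fricke5 \<tau>) ^ 6 = c ^ 6 * eta (5 * \<tau>) ^ 6"
      unfolding power_mult_distrib csqrt_pow .
    have p10: "eta_pow \<sigma> ^ 10 = inverse (eta \<sigma> ^ 6)" if "Im \<sigma> > 0" for \<sigma>
    proof -
      have "eta_pow \<sigma> ^ 10 = (eta_pow \<sigma> ^ 5) ^ 2" by (simp flip: power_mult)
      thus ?thesis unfolding eta_pow_power5[OF that] by (simp add: power_inverse flip: power_mult)
    qed
    have "fifth_root \<tau> ^ 10 = \<tau> ^ 2"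
      using power_mult[of "fifth_root \<tau>" 5 2] fifth_root_power5[OF nz] by simp
    hence "R \<tau> ^ 10 = inverse (eta (fricke5 \<tau>) ^ 6) / (\<tau> ^ 2 * (\<i> / \<tau>) ^ 5 * inverse (eta (5 * \<tau>) ^ 6))"
      using \<tau> Im_fricke5_pos unfolding R_def Q_def power_divide power_mult_distrib csqrt_pow
      by (simp add: p10 power_divide)
    also have "\<dots> = (eta (5 * \<tau>) ^ 6 / eta (fricke5 \<tau>) ^ 6) / (\<tau> ^ 2 * (\<i> / \<tau>) ^ 5)"
      by (simp add: field_simps)
    also have "eta (5 * \<tau>) ^ 6 / eta (fricke5 \<tau>) ^ 6 = (3 * \<i> / (5 * \<tau>)) ^ 3 / c ^ 6"
      using e6 n1 \<open>c \<noteq> 0\<close> by (simp add: frac_eq_eq mult_ac)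
    also have "\<dots> / (\<tau> ^ 2 * (\<i> / \<tau>) ^ 5) = (3 / 5) ^ 3 / (c ^ 6 * \<i> ^ 2)"
      using nz \<open>c \<noteq> 0\<close> by (simp add: power_divide power_mult_distrib field_simps eval_nat_numeral)
    finally show ?thesis .
  qed
  have "R constant_on ?U"
  proof (rule continuous_finite_range_constant)
    show "connected ?U" by (intro convex_connected convex_halfspace_Im_gt)
    \<comment> \<open>The principal square root is continuous here because i/\<tau> lies in the
      right half-plane.\<close>
    have nonpos: "\<i> / \<tau> \<notin> \<real>\<^sub>\<le>\<^sub>0" if "\<tau> \<in> ?U" for \<tau>
    proof -
      have "Re (\<i> / \<tau>) = Im \<tau> / (cmod \<tau>)\<^sup>2" by (simp add: Re_divide cmod_power2)
      moreover have "\<tau> \<noteq> 0" using that by auto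
      ultimately have "Re (\<i> / \<tau>) > 0" using that by simp
      thus ?thesis by (auto simp: complex_nonpos_Reals_iff)
    qed
    show "continuous_on ?U R" unfolding R_def
    proof (intro continuous_on_divide ballI Q_nz)
      show "continuous_on ?U (\<lambda>\<tau>. eta_pow (fricke5 \<tau>))"
        by (rule continuous_on_compose2[OF continuous_on_eta_pow])
           (use Im_fricke5_pos in \<open>auto simp: fricke5_def[abs_def] intro!: continuous_intros\<close>)
      have "continuous_on ?U (\<lambda>\<tau>. eta_pow (5 * \<tau>))"
        by (rule continuous_on_compose2[OF continuous_on_eta_pow]) (auto intro!: continuous_intros)
      moreover have "continuous_on ?U (\<lambda>\<tau>. csqrt (\<i> / \<tau>))"
        by (rule continuous_on_compose2[of "- \<real>\<^sub>\<le>\<^sub>0" csqrt])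
           (use nonpos in \<open>auto intro!: continuous_intros continuous_at_imp_continuous_on continuous_at_csqrt\<close>)
      ultimately show "continuous_on ?U Q"
        unfolding Q_def by (intro continuous_intros continuous_on_fifth_root)
    qed
    have "finite {z :: complex. z ^ 10 = (3 / 5) ^ 3 / (c ^ 6 * \<i> ^ 2)}" by (rule finite_nth_roots) simp
    thus "finite (R ` ?U)" by (rule rev_finite_subset) (use R10 in auto)
  qed
  then obtain \<kappa> where "\<And>\<tau>. \<tau> \<in> ?U \<Longrightarrow> R \<tau> = \<kappa>" by (auto simp: constant_on_def)
  hence "eta_pow (fricke5 \<tau>) = \<kappa> * Q \<tau>" if "Im \<tau> > 0" for \<tau>
    using that Q_nz[of \<tau>] unfolding R_def by (simp add: divide_eq_eq)
  thus ?thesis unfolding Q_def by blast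
qed

subsection \<open>The quintic theta functions\<close>

text \<open>Poisson summation with s = -i \<tau>, whose dual modulus is that of the Fricke image. In
  \<open>w\<close>, the part 1/2 encodes the sign (-1)^n and the part r/(10\<tau>) the shift
  r/10.\<close>

lemma jtheta_fricke5:
  assumes "Im \<tau> > 0"
  shows "csqrt (\<i> / \<tau>) * jtheta (5 * of_real pi * \<i> * fricke5 \<tau>) (of_real pi * \<i> - r * of_real pi
      * \<i> * fricke5 \<tau>) =
    exp (of_real pi * \<i> * \<tau> / 4 + of_real pi * \<i> * r ^ 2 / (100 * \<tau>) - of_real pi * \<i> * r / 10)
      * jtheta (of_real pi * \<i> * \<tau>) (of_real pi * \<i> * r / 5 - of_real pi * \<i> * \<tau>)"
proof -
  have nz: "\<tau> \<noteq> 0" using assms by auto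
  define s where "s = - \<i> * \<tau>"
  define w where "w = 1 / 2 + r / (10 * \<tau>)"
  have Re_s: "Re s > 0" using assms by (simp add: s_def)
  have 1: "- (of_real pi * s * w ^ 2) = of_real pi * \<i> * \<tau> / 4 + of_real pi * \<i> * r / 10
      + of_real pi * \<i> * r ^ 2 / (100 * \<tau>)"
    using nz by (simp add: s_def w_def power2_eq_square field_simps)
  have 2: "- (of_real pi * s) = of_real pi * \<i> * \<tau>" by (simp add: s_def)
  have 3: "- (2 * of_real pi * s * w) = of_real pi * \<i> * \<tau> + of_real pi * \<i> * r / 5"
    using nz by (simp add: s_def w_def field_simps)
  have 4: "- (of_real pi / s) = 5 * of_real pi * \<i> * fricke5 \<tau>" "1 / s = \<i> / \<tau>"
    using nz by (simp_all add: s_def fricke5_def field_simps)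
  have 5: "2 * of_real pi * \<i> * w = of_real pi * \<i> - r * of_real pi * \<i> * fricke5 \<tau>"
    using nz by (simp add: w_def fricke5_def field_simps)
  have "Re (of_real pi * \<i> * \<tau>) < 0" using assms by simp
  \<comment> \<open>Poisson summation yields the exponents (n^2 + n)/2; one index shift turns them
    into the (n^2 - n)/2 of C and D.\<close>
  from jtheta_period[OF this, of "of_real pi * \<i> * r / 5 - of_real pi * \<i> * \<tau>"]
  have 6: "jtheta (of_real pi * \<i> * \<tau>) (of_real pi * \<i> * \<tau> + of_real pi * \<i> * r / 5) =
     exp (- (of_real pi * \<i> * r / 5)) * jtheta (of_real pi * \<i> * \<tau>) (of_real pi * \<i>
         * r / 5 - of_real pi * \<i> * \<tau>)"
    by (simp add: algebra_simps exp_minus)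
  have 7: "exp (of_real pi * \<i> * \<tau> / 4 + of_real pi * \<i> * r / 10 + of_real pi * \<i> * r ^ 2 / (100 * \<tau>)) *
      exp (- (of_real pi * \<i> * r / 5)) =
      exp (of_real pi * \<i> * \<tau> / 4 + of_real pi * \<i> * r ^ 2 / (100 * \<tau>) - of_real pi * \<i> * r / 10)"
    unfolding exp_add[symmetric] by (rule arg_cong[of _ _ exp]) simp
  show ?thesis
    using jtheta_transform[OF Re_s, of w] unfolding 1 2 3 4 5 6 mult.assoc[symmetric] 7 by (rule sym)
qed

text \<open>Oddness of r makes 5n^2 - r n even, so the integer division is exact.\<close>

lemma alternating_theta_sum:
  assumes "odd r"
  shows "(\<Sum>\<^sub>\<infinity>n::int. (-1) powi n * nome \<tau> powi ((5 * n^2 - r * n) div 2)) =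
     jtheta (5 * of_real pi * \<i> * \<tau>) (of_real pi * \<i> - of_int r * of_real pi * \<i> * \<tau>)"
  unfolding jtheta_def
proof (rule infsum_cong)
  fix n :: int
  have "even (5 * n^2 - r * n)" using assms by auto
  thus "(-1) powi n * nome \<tau> powi ((5 * n^2 - r * n) div 2) =
    exp (5 * of_real pi * \<i> * \<tau> * of_int n ^ 2 + (of_real pi * \<i> - of_int r * of_real pi * \<i> * \<tau>)
        * of_int n)"
    by (simp add: nome_powi_half powi_neg1_eq_exp algebra_simps flip: exp_add)
qed

lemma character_theta_sum:
  "(\<Sum>\<^sub>\<infinity>n::int. exp (c * of_int n) * nome \<tau> powi ((n^2 - n) div 2)) =
     jtheta (of_real pi * \<i> * \<tau>) (c - of_real pi * \<i> * \<tau>)"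
  unfolding jtheta_def
proof (rule infsum_cong)
  fix n :: int
  have "even (n^2 - n)" by simp
  thus "exp (c * of_int n) * nome \<tau> powi ((n^2 - n) div 2) =
    exp (of_real pi * \<i> * \<tau> * of_int n ^ 2 + (c - of_real pi * \<i> * \<tau>) * of_int n)"
    by (simp add: nome_powi_half algebra_simps flip: exp_add)
qed

text \<open>For \<open>r = 3\<close> this relates \<open>A\<close> and \<open>C\<close>, for \<open>r = 1\<close> it relates \<open>B\<close> and \<open>D\<close>.\<close>
lemma quintic_theta_fricke5:
  "\<exists>\<gamma>. \<forall>\<tau>. Im \<tau> > 0 \<longrightarrow>
     exp (of_real pi * \<i> * of_int (r ^ 2 - 1) * fricke5 \<tau> / 20) * euler_pow (nome (fricke5 \<tau>)) *
       jtheta (5 * of_real pi * \<i> * fricke5 \<tau>) (of_real pi * \<i> - of_int r * of_real pi * \<i> * fricke5 \<tau>) =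
     \<gamma> * fifth_root \<tau> *
       (euler_pow (nome \<tau> ^ 5) * jtheta (of_real pi * \<i> * \<tau>) (of_real pi * \<i>
           * of_int r / 5 - of_real pi * \<i> * \<tau>))"
proof -
  obtain \<kappa> where \<kappa>: "\<And>\<tau>. Im \<tau> > 0 \<Longrightarrow> eta_pow (fricke5 \<tau>) = \<kappa> * (fifth_root \<tau> * csqrt (\<i> / \<tau>)
      * eta_pow (5 * \<tau>))"
    using eta_pow_fricke5 by blast
  show ?thesis
  proof (intro exI allI impI)
    fix \<tau> :: complex assume \<tau>: "Im \<tau> > 0"
    hence nz: "\<tau> \<noteq> 0" by auto
    define J where "J = jtheta (5 * of_real pi * \<i> * fricke5 \<tau>) (of_real pi * \<i> - of_int r
        * of_real pi * \<i> * fricke5 \<tau>)"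
    define K where "K = jtheta (of_real pi * \<i> * \<tau>) (of_real pi * \<i> * of_int r / 5 - of_real pi * \<i> * \<tau>)"
    have "euler_pow (nome (fricke5 \<tau>)) = exp (of_real pi * \<i> * fricke5 \<tau> / 20) * eta_pow (fricke5 \<tau>)"
      unfolding eta_pow_def mult.assoc[symmetric] exp_add[symmetric] by simp
    also have "\<dots> = exp (of_real pi * \<i> * fricke5 \<tau> / 20) * (\<kappa> * (fifth_root \<tau> * csqrt (\<i> / \<tau>)
        * eta_pow (5 * \<tau>)))"
      unfolding \<kappa>[OF \<tau>] ..
    finally have "exp (of_real pi * \<i> * of_int (r ^ 2 - 1) * fricke5 \<tau> / 20)
        * euler_pow (nome (fricke5 \<tau>)) * J =
       (exp (of_real pi * \<i> * of_int (r ^ 2 - 1) * fricke5 \<tau> / 20) * exp (of_real pi * \<i>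
           * fricke5 \<tau> / 20)) *
        \<kappa> * fifth_root \<tau> * eta_pow (5 * \<tau>) * (csqrt (\<i> / \<tau>) * J)" by (simp only: mult_ac)
    \<comment> \<open>The exponents add up to r^2/20, and at -1/(5\<tau>) this gives
      -r^2/(100\<tau>), which cancels the corresponding term of
      \<open>jtheta_fricke5\<close>.\<close>
    also have "exp (of_real pi * \<i> * of_int (r ^ 2 - 1) * fricke5 \<tau> / 20) * exp (of_real pi * \<i>
        * fricke5 \<tau> / 20) =
        exp (- (of_real pi * \<i> * of_int r ^ 2 / (100 * \<tau>)))"
      unfolding exp_add[symmetric] using nz by (intro arg_cong[of _ _ exp]) (simp add: fricke5_def field_simps)
    also have "csqrt (\<i> / \<tau>) * J = exp (of_real pi * \<i> * \<tau> / 4 + of_real pi * \<i>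
        * of_int r ^ 2 / (100 * \<tau>) - of_real pi * \<i> * of_int r / 10) * K"
      unfolding J_def K_def by (rule jtheta_fricke5[OF \<tau>])
    \<comment> \<open>The factor e^(-pi i \<tau>/4) coming from eta at 5\<tau> cancels the remaining
      exponential in \<tau>; only e^(-pi i r/10) survives and enters the constant.\<close>
    also have "eta_pow (5 * \<tau>) = exp (- (of_real pi * \<i> * \<tau> / 4)) * euler_pow (nome \<tau> ^ 5)"
    proof -
      have "nome (5 * \<tau>) = nome \<tau> ^ 5" by (simp add: nome_def mult_ac flip: exp_of_nat_mult)
      thus ?thesis by (simp add: eta_pow_def mult_ac)
    qed
    also have "exp (- (of_real pi * \<i> * of_int r ^ 2 / (100 * \<tau>))) * \<kappa> * fifth_root \<tau> *
        (exp (- (of_real pi * \<i> * \<tau> / 4)) * euler_pow (nome \<tau> ^ 5)) *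
        (exp (of_real pi * \<i> * \<tau> / 4 + of_real pi * \<i> * of_int r ^ 2 / (100 * \<tau>) - of_real pi * \<i>
            * of_int r / 10) * K) =
      (exp (- (of_real pi * \<i> * of_int r ^ 2 / (100 * \<tau>))) * exp (- (of_real pi * \<i> * \<tau> / 4)) *
        exp (of_real pi * \<i> * \<tau> / 4 + of_real pi * \<i> * of_int r ^ 2 / (100 * \<tau>) - of_real pi * \<i>
            * of_int r / 10)) *
         \<kappa> * fifth_root \<tau> * (euler_pow (nome \<tau> ^ 5) * K)" by (simp only: mult_ac)
    also have "exp (- (of_real pi * \<i> * of_int r ^ 2 / (100 * \<tau>))) * exp (- (of_real pi * \<i> * \<tau> / 4)) *
        exp (of_real pi * \<i> * \<tau> / 4 + of_real pi * \<i> * of_int r ^ 2 / (100 * \<tau>) - of_real pi * \<i>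
            * of_int r / 10) =
        exp (- (of_real pi * \<i> * of_int r / 10))"
      unfolding exp_add[symmetric] by simp
    finally show "exp (of_real pi * \<i> * of_int (r ^ 2 - 1) * fricke5 \<tau> / 20)
        * euler_pow (nome (fricke5 \<tau>)) * J =
      (exp (- (of_real pi * \<i> * of_int r / 10)) * \<kappa>) * fifth_root \<tau> * (euler_pow (nome \<tau> ^ 5) * K)" .
  qed
qed

text \<open>The real part is 1 + cos x > 0. This allows the denominators of C and D to be moved into
  the constants.\<close>

lemma one_plus_exp_nonzero:
  assumes "\<bar>x\<bar> < pi"
  shows "1 + exp (of_real x * \<i>) \<noteq> 0"
proof -
  have "cos pi < cos \<bar>x\<bar>" using assms by (intro cos_monotone_0_pi) auto
  hence "Re (1 + exp (of_real x * \<i>)) > 0" by (simp add: Re_exp)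
  thus ?thesis by (metis less_irrefl zero_complex.sel(1))
qed

theorem theorem1p5:
  shows "\<exists>\<gamma>\<^sub>1 \<gamma>\<^sub>2 :: complex. \<forall>\<tau> :: complex. Im \<tau> > 0 \<longrightarrow>
           qtheta_A (fricke5 \<tau>) = \<gamma>\<^sub>1 * fifth_root \<tau> * qtheta_C \<tau> \<and>
           qtheta_B (fricke5 \<tau>) = \<gamma>\<^sub>2 * fifth_root \<tau> * qtheta_D \<tau>"
proof -
  \<comment> \<open>For r = 3 the exponent (r^2 - 1)/20 = 2/5 is the prefactor q^(1/5) of A; for r =
    1 it is zero, in agreement with B.\<close>
  obtain \<gamma>A where A: "\<And>\<tau>. Im \<tau> > 0 \<Longrightarrow>
     exp (of_real pi * \<i> * of_int (3 ^ 2 - 1) * fricke5 \<tau> / 20) * euler_pow (nome (fricke5 \<tau>)) *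
       jtheta (5 * of_real pi * \<i> * fricke5 \<tau>) (of_real pi * \<i> - of_int 3 * of_real pi * \<i> * fricke5 \<tau>) =
     \<gamma>A * fifth_root \<tau> *
       (euler_pow (nome \<tau> ^ 5) * jtheta (of_real pi * \<i> * \<tau>) (of_real pi * \<i>
           * of_int 3 / 5 - of_real pi * \<i> * \<tau>))"
    using quintic_theta_fricke5[of 3] by blast
  obtain \<gamma>B where B: "\<And>\<tau>. Im \<tau> > 0 \<Longrightarrow>
     exp (of_real pi * \<i> * of_int (1 ^ 2 - 1) * fricke5 \<tau> / 20) * euler_pow (nome (fricke5 \<tau>)) *
       jtheta (5 * of_real pi * \<i> * fricke5 \<tau>) (of_real pi * \<i> - of_int 1 * of_real pi * \<i> * fricke5 \<tau>) =
     \<gamma>B * fifth_root \<tau> *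
       (euler_pow (nome \<tau> ^ 5) * jtheta (of_real pi * \<i> * \<tau>) (of_real pi * \<i>
           * of_int 1 / 5 - of_real pi * \<i> * \<tau>))"
    using quintic_theta_fricke5[of 1] by blast
  have nzC: "1 + exp (3 * of_real pi * \<i> / 5) \<noteq> 0"
    using one_plus_exp_nonzero[of "3 * pi / 5"] by (simp add: mult_ac)
  have nzD: "1 + exp (of_real pi * \<i> / 5) \<noteq> 0"
    using one_plus_exp_nonzero[of "pi / 5"] by simp
  have sumC: "(\<Sum>\<^sub>\<infinity>n::int. exp (3 * of_real pi * \<i> * of_int n / 5) * nome \<tau> powi ((n^2 - n) div 2)) =
     jtheta (of_real pi * \<i> * \<tau>) (of_real pi * \<i> * of_int 3 / 5 - of_real pi * \<i> * \<tau>)" for \<tau>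
    using character_theta_sum[of "of_real pi * \<i> * of_int 3 / 5" \<tau>] by (simp add: mult_ac)
  have sumD: "(\<Sum>\<^sub>\<infinity>n::int. exp (of_real pi * \<i> * of_int n / 5) * nome \<tau> powi ((n^2 - n) div 2)) =
     jtheta (of_real pi * \<i> * \<tau>) (of_real pi * \<i> * of_int 1 / 5 - of_real pi * \<i> * \<tau>)" for \<tau>
    using character_theta_sum[of "of_real pi * \<i> * of_int 1 / 5" \<tau>] by (simp add: mult_ac)
  show ?thesis
  proof (intro exI allI impI conjI)
    fix \<tau> :: complex assume \<tau>: "Im \<tau> > 0"
    show "qtheta_A (fricke5 \<tau>) = (\<gamma>A * (1 + exp (3 * of_real pi * \<i> / 5))) * fifth_root \<tau> * qtheta_C \<tau>"
      using A[OF \<tau>] alternating_theta_sum[of 3 "fricke5 \<tau>"] nzC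
      unfolding qtheta_A_def qtheta_C_def Let_def sumC by (simp add: mult_ac)
    show "qtheta_B (fricke5 \<tau>) = (\<gamma>B * (1 + exp (of_real pi * \<i> / 5))) * fifth_root \<tau> * qtheta_D \<tau>"
      using B[OF \<tau>] alternating_theta_sum[of 1 "fricke5 \<tau>"] nzD
      unfolding qtheta_B_def qtheta_D_def Let_def sumD by (simp add: mult_ac)
  qed
qed

end
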